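(* Let $d\ge3$, let $H\le\mathrm{Aut}(T_d)$ be locally transitive and contain an involutive inversion, and let $k\in\mathbb{N}$. Then $H^{(P_k)}=\mathrm{U}_k^{(l)}(F^{(k)})$ for some labelling $l$ of $T_d$ and some $F^{(k)}\le\mathrm{Aut}(B_{d,k})$.
   Context: $\Omega$ is a set of cardinality $d\ge3$, and $T_d=(V,E)$ is the $d$-regular tree (Serre's convention: $E$ consists of oriented edges with inversion $e\mapsto\overline e$; $E(x)$ is the set of edges with origin $x$). An inversion is an automorphism mapping some edge $e$ to $\overline e$; it is involutive if it has order $2$. $H$ is locally transitive if for every $x\in V$ the stabilizer $H_x$ acts transitively on $E(x)$. For $k\in\mathbb{N}=\{1,2,\dots\}$, the $(P_k)$-closure of $H\le\mathrm{Aut}(T_d)$ is $$H^{(P_k)}=\{g\in\mathrm{Aut}(T_d)\mid\forall x\in V\ \exists h\in H:\ g|_{B(x,k)}=h|_{B(x,k)}\},$$ where $B(x,k)$ is the ball of radius $k$ around $x$. A labelling of $T_d$ is a map $l:E\to\Omega$ such that for each $x\in V$ the restriction $l_x:E(x)\to\Omega$ is bijective, and $l(e)=l(\overline e)$ for all $e\in E$. $B_{d,k}$ is a fixed labelled tree isomorphic to a ball of radius $k$ in the labelled tree $T_d$; for $x\in V$ let $l_x^k:B(x,k)\to B_{d,k}$ be the unique label-respecting isomorphism. For $g\in\mathrm{Aut}(T_d)$ put $\sigma_k(g,x):=l_{gx}^k\circ g\circ(l_x^k)^{-1}\in\mathrm{Aut}(B_{d,k})$. For $F\le\mathrm{Aut}(B_{d,k})$,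 $$\mathrm{U}_k^{(l)}(F):=\{g\in\mathrm{Aut}(T_d)\mid\forall x\in V:\ \sigma_k(g,x)\in F\}.$$ *)

theory Defs
  imports
    "Graph_Theory.Digraph_Component"
    "HOL-Algebra.Bij"
    "HOL-Algebra.Multiplicative_Group"
begin

section \<open>Regular trees\<close>

text \<open>
  Graphs in the sense of Serre (oriented edges, with inversion) are modelled by symmetric loopfree
  pair digraphs: \<open>parcs T\<close> is the set of oriented edges, an edge is the pair of its origin
  and its terminus, and edge inversion is \<^const>\<open>prod.swap\<close>. For trees this loses nothing, since
  trees have neither loops nor multiple edges.

  The predicate \<open>tree\<close> of \<open>Graph_Theory\<close> is meant for directed graphs and treats \<open>a, b, a\<close>
  as a cycle; it fails for every symmetric graph with an edge. Hence the length bound below.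
\<close>

definition serre_tree :: "'v pair_pre_digraph \<Rightarrow> bool" where
  "serre_tree T \<longleftrightarrow> pair_bidirected_digraph T \<and> connected (with_proj T) \<and>
     \<not> (\<exists>p. pre_digraph.cycle (with_proj T) p \<and> 3 \<le> length p)"

definition regular_tree :: "nat \<Rightarrow> 'v pair_pre_digraph \<Rightarrow> bool" where
  "regular_tree d T \<longleftrightarrow> serre_tree T \<and> (\<forall>x\<in>pverts T. out_degree (with_proj T) x = d)"

definition ball_verts :: "'v pair_pre_digraph \<Rightarrow> 'v \<Rightarrow> nat \<Rightarrow> 'v set" where
  "ball_verts T x k = {y. \<exists>p. pre_digraph.awalk (with_proj T) x p y \<and> length p \<le> k}"

definition ball_graph :: "'v pair_pre_digraph \<Rightarrow> 'v \<Rightarrow> nat \<Rightarrow> 'v pair_pre_digraph" where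
  "ball_graph T x k =
     \<lparr>pverts = ball_verts T x k, parcs = parcs T \<inter> (ball_verts T x k \<times> ball_verts T x k)\<rparr>"

section \<open>Automorphism groups\<close>

text \<open>
  As in \<^theory>\<open>HOL-Algebra.Bij\<close>, maps are extensional, so that equality of morphisms is equality of
  functions. The action on edges is the one induced by the action on vertices.
\<close>

definition graph_isos :: "'v pair_pre_digraph \<Rightarrow> 'w pair_pre_digraph \<Rightarrow> ('v \<Rightarrow> 'w) set" where
  "graph_isos G G' = {f \<in> extensional (pverts G). bij_betw f (pverts G) (pverts G') \<and>
     (\<forall>x\<in>pverts G. \<forall>y\<in>pverts G. (x, y) \<in> parcs G \<longleftrightarrow> (f x, f y) \<in> parcs G')}"

definition Aut :: "'v pair_pre_digraph \<Rightarrow> ('v \<Rightarrow> 'v) monoid" where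
  "Aut G = BijGroup (pverts G) \<lparr>carrier := graph_isos G G\<rparr>"

lemma subgroup_graph_isos: "subgroup (graph_isos G G) (BijGroup (pverts G))"
proof (rule subgroup.intro)
  show sub: "graph_isos G G \<subseteq> carrier (BijGroup (pverts G))"
    by (auto simp: graph_isos_def BijGroup_def Bij_def)
  show "\<one>\<^bsub>BijGroup (pverts G)\<^esub> \<in> graph_isos G G"
    using id_Bij[of "pverts G"] by (auto simp: graph_isos_def BijGroup_def Bij_def)
next
  fix f g assume fg: "f \<in> graph_isos G G" "g \<in> graph_isos G G"
  then have B: "f \<in> Bij (pverts G)" "g \<in> Bij (pverts G)"
    by (auto simp: graph_isos_def Bij_def)
  moreover have "compose (pverts G) f g \<in> Bij (pverts G)"
    using B by (rule compose_Bij)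
  moreover have "\<And>x. x \<in> pverts G \<Longrightarrow> g x \<in> pverts G"
    using B(2) Bij_imp_funcset by blast
  ultimately show "f \<otimes>\<^bsub>BijGroup (pverts G)\<^esub> g \<in> graph_isos G G"
    using fg by (auto simp: graph_isos_def BijGroup_def Bij_def compose_def)
next
  fix f assume f: "f \<in> graph_isos G G"
  then have B: "f \<in> Bij (pverts G)" by (auto simp: graph_isos_def Bij_def)
  let ?g = "\<lambda>x\<in>pverts G. inv_into (pverts G) f x"
  have gB: "?g \<in> Bij (pverts G)" using B by (rule restrict_inv_into_Bij)
  have g: "?g x \<in> pverts G" "f (?g x) = x" if "x \<in> pverts G" for x
    using that B by (auto simp: Bij_inv_into_mem Bij_def bij_betw_inv_into_right)
  have "(x, y) \<in> parcs G \<longleftrightarrow> (?g x, ?g y) \<in> parcs G" if "x \<in> pverts G" "y \<in> pverts G" for x y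
  proof -
    have "\<forall>x\<in>pverts G. \<forall>y\<in>pverts G. (x, y) \<in> parcs G \<longleftrightarrow> (f x, f y) \<in> parcs G"
      using f by (simp add: graph_isos_def)
    then have "(?g x, ?g y) \<in> parcs G \<longleftrightarrow> (f (?g x), f (?g y)) \<in> parcs G"
      using g(1)[OF that(1)] g(1)[OF that(2)] by blast
    then show ?thesis by (simp only: g(2)[OF that(1)] g(2)[OF that(2)])
  qed
  then have "?g \<in> graph_isos G G"
    using gB unfolding graph_isos_def Bij_def by blast
  then show "inv\<^bsub>BijGroup (pverts G)\<^esub> f \<in> graph_isos G G"
    using B by (simp add: inv_BijGroup)
qed

lemma group_Aut: "group (Aut G)"
  unfolding Aut_def
  by (rule subgroup.subgroup_is_group[OF subgroup_graph_isos group_BijGroup])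

definition locally_transitive :: "'v pair_pre_digraph \<Rightarrow> ('v \<Rightarrow> 'v) set \<Rightarrow> bool" where
  "locally_transitive T H \<longleftrightarrow> (\<forall>x\<in>pverts T.
     \<forall>e\<in>out_arcs (with_proj T) x. \<forall>e'\<in>out_arcs (with_proj T) x.
       \<exists>h\<in>{h \<in> H. h x = x}. map_prod h h e = e')"

definition inversion :: "'v pair_pre_digraph \<Rightarrow> ('v \<Rightarrow> 'v) \<Rightarrow> bool" where
  "inversion T g \<longleftrightarrow> g \<in> carrier (Aut T) \<and> (\<exists>e\<in>parcs T. map_prod g g e = prod.swap e)"

definition involutive_inversion :: "'v pair_pre_digraph \<Rightarrow> ('v \<Rightarrow> 'v) \<Rightarrow> bool" where
  "involutive_inversion T g \<longleftrightarrow> inversion T g \<and> group.ord (Aut T) g = 2"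

definition Pk_closure :: "'v pair_pre_digraph \<Rightarrow> nat \<Rightarrow> ('v \<Rightarrow> 'v) set \<Rightarrow> ('v \<Rightarrow> 'v) set" where
  "Pk_closure T k H = {g \<in> carrier (Aut T). \<forall>x\<in>pverts T. \<exists>h\<in>H.
     restrict g (ball_verts T x k) = restrict h (ball_verts T x k)}"

section \<open>Labellings and universal groups\<close>

definition labelling :: "'v pair_pre_digraph \<Rightarrow> 'o set \<Rightarrow> ('v \<times> 'v \<Rightarrow> 'o) \<Rightarrow> bool" where
  "labelling T \<Omega> l \<longleftrightarrow> (\<forall>x\<in>pverts T. bij_betw l (out_arcs (with_proj T) x) \<Omega>) \<and>
     (\<forall>e\<in>parcs T. l e = l (prod.swap e))"

definition label_isos :: "'v pair_pre_digraph \<Rightarrow> ('v \<times> 'v \<Rightarrow> 'o) \<Rightarrow>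
    'w pair_pre_digraph \<Rightarrow> ('w \<times> 'w \<Rightarrow> 'o) \<Rightarrow> ('v \<Rightarrow> 'w) set" where
  "label_isos G l G' l' = {f \<in> graph_isos G G'. \<forall>e\<in>parcs G. l' (map_prod f f e) = l e}"

text \<open>
  \<open>(B, m)\<close> is a choice of the labelled tree \<open>B\<^sub>d\<^sub>,\<^sub>k\<close>. It does not matter which labelling and which
  centre are used: any two balls of radius \<open>k\<close> in labelled \<open>d\<close>-regular trees are isomorphic as
  labelled trees.
\<close>

definition labelled_ball_model ::
    "'v pair_pre_digraph \<Rightarrow> 'o set \<Rightarrow> nat \<Rightarrow> 'b pair_pre_digraph \<Rightarrow> ('b \<times> 'b \<Rightarrow> 'o) \<Rightarrow> bool" where
  "labelled_ball_model T \<Omega> k B m \<longleftrightarrow> serre_tree B \<and>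
     (\<exists>l x. labelling T \<Omega> l \<and> x \<in> pverts T \<and> label_isos (ball_graph T x k) l B m \<noteq> {})"

text \<open>
  The map \<open>l\<^sub>x\<^sup>k\<close>. For \<open>k \<ge> 1\<close> and \<open>d \<ge> 3\<close> the label-respecting isomorphism is indeed unique; it
  necessarily sends \<open>x\<close> to the centre of \<open>B\<close>.
\<close>

definition ball_label :: "'v pair_pre_digraph \<Rightarrow> ('v \<times> 'v \<Rightarrow> 'o) \<Rightarrow> nat \<Rightarrow>
    'b pair_pre_digraph \<Rightarrow> ('b \<times> 'b \<Rightarrow> 'o) \<Rightarrow> 'v \<Rightarrow> 'v \<Rightarrow> 'b" where
  "ball_label T l k B m x = (THE f. f \<in> label_isos (ball_graph T x k) l B m)"

definition local_action :: "'v pair_pre_digraph \<Rightarrow> ('v \<times> 'v \<Rightarrow> 'o) \<Rightarrow> nat \<Rightarrow>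
    'b pair_pre_digraph \<Rightarrow> ('b \<times> 'b \<Rightarrow> 'o) \<Rightarrow> ('v \<Rightarrow> 'v) \<Rightarrow> 'v \<Rightarrow> 'b \<Rightarrow> 'b" where
  "local_action T l k B m g x = (\<lambda>b\<in>pverts B.
     ball_label T l k B m (g x) (g (inv_into (ball_verts T x k) (ball_label T l k B m x) b)))"

definition universal_group :: "'v pair_pre_digraph \<Rightarrow> ('v \<times> 'v \<Rightarrow> 'o) \<Rightarrow> nat \<Rightarrow>
    'b pair_pre_digraph \<Rightarrow> ('b \<times> 'b \<Rightarrow> 'o) \<Rightarrow> ('b \<Rightarrow> 'b) set \<Rightarrow> ('v \<Rightarrow> 'v) set" where
  "universal_group T l k B m F =
     {g \<in> carrier (Aut T). \<forall>x\<in>pverts T. local_action T l k B m g x \<in> F}"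

end

theory Submission
  imports Defs
begin

text \<open>
  The idea is to choose the labelling so that \<open>H\<close> contains a vertex-transitive set of
  label-preserving automorphisms. Fix a vertex \<open>b\<close> at which some involution in \<open>H\<close> inverts an edge.
  Conjugating by the stabilizer of \<open>b\<close>, which is transitive on the edges at \<open>b\<close>, gives for every
  label \<open>a\<close> an involution \<open>t a\<close> in \<open>H\<close> inverting the corresponding edge at \<open>b\<close>. Since the tree has no
  cycles, these involutions generate a free product of groups of order two that acts simply
  transitively on the vertices, and translating the labels of the edges at \<open>b\<close> by this group gives
  the labelling (\<open>labelling_from_involutions\<close>, \<open>vertex_transitive_labelling\<close>).
  
  Label-preserving automorphisms have trivial local actions, since the label-respecting
  isomorphism from a ball to the model is unique (\<open>label_endomorphism_of_ball\<close>,
  \<open>local_action_label_preserving\<close>). Let \<open>F\<close> be the set of all local actions of elements of \<open>H\<close>. An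
  automorphism agreeing with elements of \<open>H\<close> on balls has its local actions in \<open>F\<close>. Conversely, if
  an automorphism has at \<open>x\<close> the local action that some \<open>h\<close> in \<open>H\<close> has at \<open>y\<close>, label-preserving
  elements of \<open>H\<close> move \<open>x\<close> to \<open>y\<close> and \<open>h y\<close> to the image of \<open>x\<close>, and composing them with \<open>h\<close> gives an
  element of \<open>H\<close> that agrees with the automorphism on the ball around \<open>x\<close>
  (\<open>Pk_closure_eq_universal_group\<close>).
  
  The bookkeeping uses words over \<open>\<Omega>\<close>. A word acts by following labels in a labelled tree, or by
  composing the involutions \<open>t a\<close>. In both cases reduced words correspond to walks without
  backtracking, so vertices correspond to reduced words (\<open>foldr_eq_iff_reduce_eq\<close>). This also
  identifies balls of any two labellings (\<open>label_iso_of_balls\<close>), whence the model fits every vertex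
  and every labelling.
\<close>

section \<open>Reduced words and systems of involutions\<close>

definition involutions_on :: "'v set \<Rightarrow> 'a set \<Rightarrow> ('a \<Rightarrow> 'v \<Rightarrow> 'v) \<Rightarrow> bool" where
  "involutions_on V \<Omega> t \<longleftrightarrow> (\<forall>a\<in>\<Omega>. \<forall>v\<in>V. t a v \<in> V \<and> t a (t a v) = v)"

definition reduced_words :: "'a set \<Rightarrow> 'a list set" where
  "reduced_words \<Omega> = {w. distinct_adj w \<and> set w \<subseteq> \<Omega>}"

text \<open>
  Reduced words are the normal forms of the free product of one copy of \<open>\<int>/2\<close> per letter, and
  \<open>cancel_cons a\<close> is left multiplication by the generator \<open>a\<close> on normal forms. A family of
  involutions is an action of this group, applied to a word by \<open>foldr\<close>: the last letter acts
  first.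
\<close>

definition cancel_cons :: "'a \<Rightarrow> 'a list \<Rightarrow> 'a list" where
  "cancel_cons a w = (if w \<noteq> [] \<and> hd w = a then tl w else a # w)"

definition reduce :: "'a list \<Rightarrow> 'a list" where
  "reduce w = foldr cancel_cons w []"

definition acts_freely_at :: "'a set \<Rightarrow> ('a \<Rightarrow> 'v \<Rightarrow> 'v) \<Rightarrow> 'v \<Rightarrow> bool" where
  "acts_freely_at \<Omega> t x \<longleftrightarrow> (\<forall>w\<in>reduced_words \<Omega>. w \<noteq> [] \<longrightarrow> foldr t w x \<noteq> x)"

lemma involutions_onD:
  assumes "involutions_on V \<Omega> t" "a \<in> \<Omega>" "v \<in> V"
  shows "t a v \<in> V" "t a (t a v) = v"
  using assms by (auto simp: involutions_on_def)

lemma foldr_in_set: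
  assumes "involutions_on V \<Omega> t" "set w \<subseteq> \<Omega>" "v \<in> V"
  shows "foldr t w v \<in> V"
  using assms(2) by (induction w) (auto simp: involutions_onD[OF assms(1)] assms(3))

lemma foldr_rev_foldr:
  assumes "involutions_on V \<Omega> t" "set w \<subseteq> \<Omega>" "v \<in> V"
  shows "foldr t (rev w) (foldr t w v) = v"
  using assms(2)
  by (induction w) (auto simp: involutions_onD[OF assms(1)] foldr_in_set[OF assms(1) _ assms(3)])

lemma foldr_foldr_rev:
  assumes "involutions_on V \<Omega> t" "set w \<subseteq> \<Omega>" "v \<in> V"
  shows "foldr t w (foldr t (rev w) v) = v"
  using foldr_rev_foldr[of V \<Omega> t "rev w" v] assms by simp

text \<open>
  The group acts on its own normal forms. This regular action makes cancellation in \<open>reduce\<close> a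
  matter of undoing involutions, so that no confluence argument for rewriting of words is needed.
\<close>

lemma involutions_cancel_cons: "involutions_on (reduced_words \<Omega>) \<Omega> cancel_cons"
proof -
  have "cancel_cons a w \<in> reduced_words \<Omega> \<and> cancel_cons a (cancel_cons a w) = w"
    if "a \<in> \<Omega>" "w \<in> reduced_words \<Omega>" for a w
    using that by (cases w) (auto simp: cancel_cons_def reduced_words_def distinct_adj_Cons)
  then show ?thesis by (simp add: involutions_on_def)
qed

lemma Nil_reduced: "[] \<in> reduced_words \<Omega>"
  by (simp add: reduced_words_def)

lemma reduce_reduced: "set w \<subseteq> \<Omega> \<Longrightarrow> reduce w \<in> reduced_words \<Omega>"
  unfolding reduce_def by (rule foldr_in_set[OF involutions_cancel_cons _ Nil_reduced])

lemma reduce_of_reduced: "w \<in> reduced_words \<Omega> \<Longrightarrow> reduce w = w"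
  by (induction w) (auto simp: reduce_def reduced_words_def cancel_cons_def distinct_adj_Cons)

lemma length_reduce: "length (reduce w) \<le> length w"
  by (induction w) (auto simp: reduce_def cancel_cons_def)

lemma foldr_cancel_cons:
  assumes "involutions_on V \<Omega> t" "a \<in> \<Omega>" "set w \<subseteq> \<Omega>" "v \<in> V"
  shows "foldr t (cancel_cons a w) v = t a (foldr t w v)"
proof (cases w)
  case (Cons b u)
  then show ?thesis
    using assms by (auto simp: cancel_cons_def involutions_onD[OF assms(1)] foldr_in_set[OF assms(1)])
qed (simp add: cancel_cons_def)

lemma foldr_reduce:
  assumes "involutions_on V \<Omega> t" "set w \<subseteq> \<Omega>" "v \<in> V"
  shows "foldr t (reduce w) v = foldr t w v"
  using assms(2)
proof (induction w)
  case (Cons a w)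
  have "set (reduce w) \<subseteq> \<Omega>"
    using reduce_reduced[of w \<Omega>] Cons.prems by (auto simp: reduced_words_def)
  with Cons show ?case
    using foldr_cancel_cons[OF assms(1) _ _ assms(3)] by (simp add: reduce_def)
qed (simp add: reduce_def)

text \<open>
  If no nonempty reduced word fixes \<open>x\<close>, then the orbit of \<open>x\<close> is a copy of the free product. The
  right-hand side mentions neither \<open>t\<close> nor \<open>x\<close>; orbits of different actions can therefore be
  identified with each other, and two words that agree at \<open>x\<close> agree everywhere.
\<close>

lemma foldr_eq_iff_reduce_eq:
  assumes t: "involutions_on V \<Omega> t" and x: "x \<in> V" and free: "acts_freely_at \<Omega> t x"
    and u: "set u \<subseteq> \<Omega>" and w: "set w \<subseteq> \<Omega>"
  shows "foldr t u x = foldr t w x \<longleftrightarrow> reduce u = reduce w"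
proof
  assume eq: "foldr t u x = foldr t w x"
  have s: "set (rev w @ u) \<subseteq> \<Omega>" using u w by auto
  have "foldr t (reduce (rev w @ u)) x = x"
    using eq foldr_reduce[OF t s x] foldr_rev_foldr[OF t w x] by simp
  then have "reduce (rev w @ u) = []"
    using free reduce_reduced[OF s] by (auto simp: acts_freely_at_def)
  then have "foldr cancel_cons (rev w) (reduce u) = []"
    by (simp add: reduce_def)
  then show "reduce u = reduce w"
    using foldr_foldr_rev[OF involutions_cancel_cons w reduce_reduced[OF u]]
    by (simp add: reduce_def)
next
  assume "reduce u = reduce w"
  then show "foldr t u x = foldr t w x"
    using foldr_reduce[OF t u x] foldr_reduce[OF t w x] by simp
qed

section \<open>Trees\<close>

lemma serre_treeD:
  assumes "serre_tree T"
  shows "(u, v) \<in> parcs T \<Longrightarrow> u \<in> pverts T" "(u, v) \<in> parcs T \<Longrightarrow> v \<in> pverts T"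
    "(u, v) \<in> parcs T \<Longrightarrow> (v, u) \<in> parcs T" "(u, v) \<in> parcs T \<Longrightarrow> u \<noteq> v"
    "u \<in> pverts T \<Longrightarrow> v \<in> pverts T \<Longrightarrow> (u, v) \<in> (parcs T)\<^sup>*"
proof -
  interpret pair_bidirected_digraph T using assms by (simp add: serre_tree_def)
  show "(u, v) \<in> parcs T \<Longrightarrow> u \<in> pverts T" "(u, v) \<in> parcs T \<Longrightarrow> v \<in> pverts T"
    "(u, v) \<in> parcs T \<Longrightarrow> (v, u) \<in> parcs T" "(u, v) \<in> parcs T \<Longrightarrow> u \<noteq> v"
    using in_arcsD1 in_arcsD2 arcs_symmetric pair_no_loops by fastforce+
  assume "u \<in> pverts T" "v \<in> pverts T"
  then have "reachable (with_proj (mk_symmetric (with_proj T))) u v"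
    using assms by (simp add: serre_tree_def connected_def strongly_connected_def)
  then have "reachable (with_proj T) u v"
    using reachable_mk_symmetric_eq[of u v] sym_arcs by simp
  then show "(u, v) \<in> (parcs T)\<^sup>*"
    using reachable_rtranclI by fastforce
qed

lemma awalk_along_function:
  assumes wf: "\<And>u v. (u, v) \<in> parcs T \<Longrightarrow> u \<in> pverts T"
    and arcs: "\<And>i. m \<le> i \<Longrightarrow> i < n \<Longrightarrow> (f i, f (Suc i)) \<in> parcs T" and "m < n"
  shows "pre_digraph.awalk (with_proj T) (f m) (map (\<lambda>i. (f i, f (Suc i))) [m..<n]) (f n)"
    "pawalk_verts (f m) (map (\<lambda>i. (f i, f (Suc i))) [m..<n]) = map f [m..<Suc n]"
proof -
  have cas: "pcas (f m) (map (\<lambda>i. (f i, f (Suc i))) [m..<m + j]) (f (m + j))" for j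
  proof (induction j arbitrary: m)
    case (Suc j)
    show ?case using Suc[of "Suc m"] by (simp add: upt_conv_Cons del: upt_Suc)
  qed simp
  have "pawalk_verts (f m) (map (\<lambda>i. (f i, f (Suc i))) [m..<m + j]) = map f [m..<Suc (m + j)]" for j
  proof (induction j arbitrary: m)
    case (Suc j)
    show ?case using Suc[of "Suc m"] by (simp add: upt_conv_Cons del: upt_Suc)
  qed simp
  from this[of "n - m"] cas[of "n - m"] assms
  show "pre_digraph.awalk (with_proj T) (f m) (map (\<lambda>i. (f i, f (Suc i))) [m..<n]) (f n)"
    "pawalk_verts (f m) (map (\<lambda>i. (f i, f (Suc i))) [m..<n]) = map f [m..<Suc n]"
    by (auto simp: pre_digraph.awalk_def cas_with_proj_eq)
qed

text \<open>
  A shortest closed part of the walk would be a cycle: it has length at least \<open>3\<close>, since length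
  \<open>1\<close> would be a loop and length \<open>2\<close> a backtracking. This is the only place where the absence of
  cycles enters; both free actions below are obtained from it.
\<close>

lemma nonbacktracking_walk_not_closed:
  assumes T: "serre_tree T" and "n > 0"
    and arcs: "\<And>i. i < n \<Longrightarrow> (f i, f (Suc i)) \<in> parcs T"
    and nb: "\<And>i. Suc (Suc i) \<le> n \<Longrightarrow> f i \<noteq> f (Suc (Suc i))"
  shows "f 0 \<noteq> f n"
proof
  assume closed: "f 0 = f n"
  define P where "P j \<longleftrightarrow> j > 0 \<and> (\<exists>i. i + j \<le> n \<and> f i = f (i + j))" for j
  have "P n" using closed \<open>n > 0\<close> by (simp add: P_def)
  define j where "j = (LEAST j. P j)"
  have "P j" unfolding j_def by (rule LeastI) fact
  then obtain i where j: "j > 0" "i + j \<le> n" "f i = f (i + j)"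
    by (auto simp: P_def)
  have min: "j \<le> j'" if "P j'" for j' unfolding j_def by (rule Least_le) fact
  have "j \<noteq> 1" using serre_treeD(4)[OF T arcs[of i]] j by auto
  moreover have "j \<noteq> 2" using nb[of i] j by auto
  ultimately have "3 \<le> j" using j by linarith
  let ?p = "map (\<lambda>i. (f i, f (Suc i))) [i..<i + j]"
  have walk: "pre_digraph.awalk (with_proj T) (f i) ?p (f i)"
    "pawalk_verts (f i) ?p = map f [i..<Suc (i + j)]"
    using awalk_along_function[of T i "i + j" f] serre_treeD(1)[OF T] arcs j by auto
  have "inj_on f {Suc i..<Suc (i + j)}"
  proof (rule linorder_inj_onI)
    fix a b assume ab: "a < b" "a \<in> {Suc i..<Suc (i + j)}" "b \<in> {Suc i..<Suc (i + j)}"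
    show "f a \<noteq> f b"
    proof
      assume "f a = f b"
      then have "P (b - a)" using ab j by (auto simp: P_def intro!: exI[of _ a])
      then show False using min[of "b - a"] ab by auto
    qed
  qed auto
  then have "distinct (tl (pawalk_verts (f i) ?p))"
    unfolding walk(2) using j
    by (subst upt_conv_Cons) (auto simp: distinct_map simp del: upt_Suc)
  then have "pre_digraph.cycle (with_proj T) ?p"
    using walk(1) j by (auto simp: pre_digraph.cycle_def awalk_verts_with_proj_eq)
  moreover have "3 \<le> length ?p" using \<open>3 \<le> j\<close> by simp
  ultimately show False using T unfolding serre_tree_def by blast
qed

lemma ball_verts_relpow:
  assumes "serre_tree T" "x \<in> pverts T"
  shows "y \<in> ball_verts T x k \<longleftrightarrow> (\<exists>n\<le>k. (x, y) \<in> parcs T ^^ n)"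
proof -
  have "(\<exists>p. pre_digraph.awalk (with_proj T) x p y \<and> length p = n) \<longleftrightarrow> (x, y) \<in> parcs T ^^ n" for n
    using assms(2)
  proof (induction n arbitrary: x)
    case 0
    then show ?case by (auto simp: pre_digraph.awalk_def cas_with_proj_eq)
  next
    case (Suc n)
    have "(\<exists>p. pre_digraph.awalk (with_proj T) x p y \<and> length p = Suc n) \<longleftrightarrow>
        (\<exists>z. (x, z) \<in> parcs T \<and> (\<exists>p. pre_digraph.awalk (with_proj T) z p y \<and> length p = n))"
    proof -
      have "(\<exists>p. pre_digraph.awalk (with_proj T) x p y \<and> length p = Suc n) \<longleftrightarrow>
          (\<exists>z p. pre_digraph.awalk (with_proj T) x ((x, z) # p) y \<and> length p = n)"
        unfolding length_Suc_conv pre_digraph.awalk_def cas_with_proj_eq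
        by (metis pcas.simps(2) prod.collapse)
      then show ?thesis
        using Suc.prems serre_treeD(2)[OF assms(1)]
        by (auto simp: pre_digraph.awalk_def cas_with_proj_eq)
    qed
    also have "\<dots> \<longleftrightarrow> (\<exists>z. (x, z) \<in> parcs T \<and> (z, y) \<in> parcs T ^^ n)"
      using Suc.IH serre_treeD(2)[OF assms(1)] by blast
    also have "\<dots> \<longleftrightarrow> (x, y) \<in> parcs T ^^ Suc n"
      by (meson relpow_Suc_D2 relpow_Suc_I2)
    finally show ?case .
  qed
  then show ?thesis unfolding ball_verts_def mem_Collect_eq by metis
qed

lemma centre_in_ball: "serre_tree T \<Longrightarrow> x \<in> pverts T \<Longrightarrow> x \<in> ball_verts T x k"
  by (auto simp: ball_verts_relpow intro: exI[of _ 0])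

lemma ball_verts_subset: 
  assumes "serre_tree T" "x \<in> pverts T" shows "ball_verts T x k \<subseteq> pverts T"
proof
  fix y assume "y \<in> ball_verts T x k"
  then obtain n where "(x, y) \<in> parcs T ^^ n" by (auto simp: ball_verts_relpow[OF assms])
  then show "y \<in> pverts T" 
    using assms serre_treeD(2)[OF assms(1)] by (cases n) auto
qed

section \<open>Labelled trees\<close>

lemma label_isos_ball_iff:
  "f \<in> label_isos (ball_graph T x k) l B m \<longleftrightarrow>
    f \<in> extensional (ball_verts T x k) \<and> bij_betw f (ball_verts T x k) (pverts B) \<and>
    (\<forall>u\<in>ball_verts T x k. \<forall>v\<in>ball_verts T x k.
      ((u, v) \<in> parcs T \<longleftrightarrow> (f u, f v) \<in> parcs B) \<and>
      ((u, v) \<in> parcs T \<longrightarrow> m (f u, f v) = l (u, v)))"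
  unfolding label_isos_def graph_isos_def ball_graph_def
  by (auto simp: Ball_def)

locale labelled_tree =
  fixes T :: "'v pair_pre_digraph" and \<Omega> :: "'o set" and l :: "'v \<times> 'v \<Rightarrow> 'o"
  assumes tree: "serre_tree T" and labelling: "labelling T \<Omega> l"
begin

text \<open>
  The vertex reached from \<open>v\<close> along the edge labelled \<open>a\<close>. As an edge and its inverse carry the same
  label, crossing twice leads back, so the labels act as involutions on the vertices.
\<close>

definition cross :: "'o \<Rightarrow> 'v \<Rightarrow> 'v" where
  "cross a v = (THE u. (v, u) \<in> parcs T \<and> l (v, u) = a)"

lemma ex1_cross:
  assumes "v \<in> pverts T" "a \<in> \<Omega>"
  shows "\<exists>!u. (v, u) \<in> parcs T \<and> l (v, u) = a"
proof -
  have bij: "bij_betw l (out_arcs (with_proj T) v) \<Omega>"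
    using labelling assms(1) by (simp add: labelling_def)
  then have "a \<in> l ` out_arcs (with_proj T) v" using assms(2) by (simp add: bij_betw_def)
  then obtain u where "(v, u) \<in> parcs T" "l (v, u) = a" by auto
  moreover have "u' = u" if "(v, u') \<in> parcs T" "l (v, u') = a" for u'
    using inj_onD[OF bij_betw_imp_inj_on[OF bij], of "(v, u')" "(v, u)"] that calculation by auto
  ultimately show ?thesis by blast
qed

lemma cross_arc:
  assumes "v \<in> pverts T" "a \<in> \<Omega>"
  shows "(v, cross a v) \<in> parcs T" "l (v, cross a v) = a"
  using theI'[OF ex1_cross[OF assms]] by (simp_all add: cross_def)

lemma label_sym: "(u, v) \<in> parcs T \<Longrightarrow> l (v, u) = l (u, v)"
  using labelling by (fastforce simp: labelling_def)

lemma cross_label: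
  assumes "(v, u) \<in> parcs T"
  shows "l (v, u) \<in> \<Omega>" "cross (l (v, u)) v = u"
proof -
  have v: "v \<in> pverts T" using serre_treeD(1)[OF tree assms] .
  have "bij_betw l (out_arcs (with_proj T) v) \<Omega>"
    using labelling v by (simp add: labelling_def)
  then show *: "l (v, u) \<in> \<Omega>" by (rule bij_betw_apply) (use assms in simp)
  show "cross (l (v, u)) v = u"
    using ex1_cross[OF v *] cross_arc[OF v *] assms by blast
qed

lemma involutions_cross: "involutions_on (pverts T) \<Omega> cross"
  unfolding involutions_on_def
proof (intro ballI conjI)
  fix a v assume a: "a \<in> \<Omega>" and v: "v \<in> pverts T"
  note arc = cross_arc[OF v a]
  show "cross a v \<in> pverts T" using serre_treeD(2)[OF tree arc(1)] .
  show "cross a (cross a v) = v"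
    using cross_label(2)[OF serre_treeD(3)[OF tree arc(1)]] label_sym[OF arc(1)] arc(2) by simp
qed

lemmas cross_cross = involutions_onD[OF involutions_cross]
lemmas follow_in_verts = foldr_in_set[OF involutions_cross]

text \<open>
  Following a reduced word never backtracks: consecutive edges at a vertex have different labels.
\<close>

lemma cross_acts_freely:
  assumes x: "x \<in> pverts T"
  shows "acts_freely_at \<Omega> cross x"
  unfolding acts_freely_at_def
proof (intro ballI impI)
  fix w assume w: "w \<in> reduced_words \<Omega>" "w \<noteq> []"
  \<comment> \<open>the last letter is crossed first, so the walk is read off from the suffixes of the word\<close>
  define f where "f i = foldr cross (drop (length w - i) w) x" for i
  have in\<Omega>: "w ! i \<in> \<Omega>" if "i < length w" for i
    using w that by (auto simp: reduced_words_def)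
  have V: "f i \<in> pverts T" for i
    unfolding f_def using w by (intro follow_in_verts x) (auto simp: reduced_words_def dest: in_set_dropD)
  have Suc_f: "f (Suc i) = cross (w ! (length w - Suc i)) (f i)" if "i < length w" for i
    using that Cons_nth_drop_Suc[of "length w - Suc i" w, symmetric]
    by (simp add: f_def Suc_diff_Suc)
  have "f 0 \<noteq> f (length w)"
  proof (rule nonbacktracking_walk_not_closed[OF tree])
    show "(f i, f (Suc i)) \<in> parcs T" if "i < length w" for i
      using cross_arc(1)[OF V in\<Omega>] that by (simp add: Suc_f)
    fix i assume i: "Suc (Suc i) \<le> length w"
    let ?a = "w ! (length w - Suc i)" and ?b = "w ! (length w - Suc (Suc i))"
    have "?b \<noteq> ?a"
      using distinct_adj_nth[of w "length w - Suc (Suc i)"] w i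
      by (auto simp: reduced_words_def Suc_diff_Suc)
    moreover have "f (Suc (Suc i)) = cross ?b (cross ?a (f i))" using i by (simp add: Suc_f)
    moreover have "?a \<in> \<Omega>" "?b \<in> \<Omega>" using i by (auto intro: in\<Omega>)
    ultimately show "f i \<noteq> f (Suc (Suc i))"
      using cross_cross V cross_arc(2) by metis
  qed (use w in simp)
  then show "foldr cross w x \<noteq> x" by (simp add: f_def)
qed

lemma follow_eq_iff:
  assumes "x \<in> pverts T" "set u \<subseteq> \<Omega>" "set w \<subseteq> \<Omega>"
  shows "foldr cross u x = foldr cross w x \<longleftrightarrow> reduce u = reduce w"
  using foldr_eq_iff_reduce_eq[OF involutions_cross] cross_acts_freely assms by blast

lemma relpow_iff_word:
  assumes x: "x \<in> pverts T"
  shows "(x, y) \<in> parcs T ^^ n \<longleftrightarrow> (\<exists>w. set w \<subseteq> \<Omega> \<and> length w = n \<and> y = foldr cross w x)"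
proof (induction n arbitrary: y)
  case 0
  show ?case by auto
next
  case (Suc n)
  show ?case
  proof
    assume "(x, y) \<in> parcs T ^^ Suc n"
    then obtain z where z: "(x, z) \<in> parcs T ^^ n" "(z, y) \<in> parcs T" by auto
    then obtain w where "set w \<subseteq> \<Omega>" "length w = n" "z = foldr cross w x" using Suc by blast
    then show "\<exists>w. set w \<subseteq> \<Omega> \<and> length w = Suc n \<and> y = foldr cross w x"
      using cross_label[OF z(2)] by (intro exI[of _ "l (z, y) # w"]) auto
  next
    assume "\<exists>w. set w \<subseteq> \<Omega> \<and> length w = Suc n \<and> y = foldr cross w x"
    then obtain a w where w: "insert a (set w) \<subseteq> \<Omega>" "length w = n" "y = cross a (foldr cross w x)"
      by (auto simp: length_Suc_conv)
    then have "(x, foldr cross w x) \<in> parcs T ^^ n" using Suc by auto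
    moreover have "(foldr cross w x, y) \<in> parcs T"
      unfolding w(3) using w(1) x by (intro cross_arc(1) follow_in_verts) auto
    ultimately show "(x, y) \<in> parcs T ^^ Suc n" by auto
  qed
qed

lemma ball_iff_word:
  assumes "x \<in> pverts T"
  shows "y \<in> ball_verts T x k \<longleftrightarrow> (\<exists>w. set w \<subseteq> \<Omega> \<and> length w \<le> k \<and> y = foldr cross w x)"
  unfolding ball_verts_relpow[OF tree assms] relpow_iff_word[OF assms] by blast

lemma label_morphism_follow:
  assumes x: "x \<in> pverts T" and gx: "g x \<in> pverts T"
    and g: "\<And>u v. (u, v) \<in> parcs (ball_graph T x k) \<Longrightarrow> (g u, g v) \<in> parcs T \<and> l (g u, g v) = l (u, v)"
    and w: "set w \<subseteq> \<Omega>" "length w \<le> k"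
  shows "g (foldr cross w x) = foldr cross w (g x)"
  using w
proof (induction w)
  case (Cons a w)
  let ?u = "foldr cross w x"
  have u: "?u \<in> pverts T" using Cons.prems x by (intro follow_in_verts) auto
  have "?u \<in> ball_verts T x k"
    unfolding ball_iff_word[OF x] using Cons.prems by (intro exI[of _ w]) auto
  moreover have "cross a ?u \<in> ball_verts T x k"
    unfolding ball_iff_word[OF x] using Cons.prems by (intro exI[of _ "a # w"]) auto
  ultimately have "(?u, cross a ?u) \<in> parcs (ball_graph T x k)"
    using cross_arc[OF u] Cons.prems by (simp add: ball_graph_def)
  with g[of ?u "cross a ?u"] have "(g ?u, g (cross a ?u)) \<in> parcs T" "l (g ?u, g (cross a ?u)) = a"
    using cross_arc[OF u] Cons.prems by auto
  then show ?case using cross_label(2) Cons by fastforce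
qed simp

text \<open>
  The map commutes with crossing edges inside the ball, hence it is determined by the image of the
  centre \<open>x\<close>. If the centre moved along a nonempty reduced word \<open>w\<close>, some walk of length \<open>k\<close> from
  the centre would be mapped to a walk that continues \<open>w\<close> without backtracking, and its end would
  leave the ball.
\<close>

lemma label_endomorphism_of_ball:
  assumes x: "x \<in> pverts T" and k: "k \<ge> 1" and \<Omega>: "\<And>c. \<exists>a\<in>\<Omega>. a \<noteq> c"
    and into: "\<And>y. y \<in> ball_verts T x k \<Longrightarrow> g y \<in> ball_verts T x k"
    and g: "\<And>u v. (u, v) \<in> parcs (ball_graph T x k) \<Longrightarrow> (g u, g v) \<in> parcs T \<and> l (g u, g v) = l (u, v)"
    and y: "y \<in> ball_verts T x k"
  shows "g y = y"
proof -
  have gx: "g x \<in> ball_verts T x k" using into centre_in_ball[OF tree x] .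
  then obtain w0 where w0: "set w0 \<subseteq> \<Omega>" "length w0 \<le> k" "g x = foldr cross w0 x"
    using ball_iff_word[OF x] by blast
  define w where "w = reduce w0"
  have w: "w \<in> reduced_words \<Omega>" "g x = foldr cross w x"
    using w0 reduce_reduced foldr_reduce[OF involutions_cross _ x] by (auto simp: w_def)
  have gxV: "g x \<in> pverts T" using gx ball_verts_subset[OF tree x] by blast
  have follow: "g (foldr cross u x) = foldr cross u (g x)" if "set u \<subseteq> \<Omega>" "length u \<le> k" for u
    using label_morphism_follow[OF x gxV g] that by blast
  have "w = []"
  proof (rule ccontr)
    assume ne: "w \<noteq> []"
    \<comment> \<open>a word of full length that does not cancel against w\<close>
    have "\<exists>u\<in>reduced_words \<Omega>. length u = n \<and> u \<noteq> [] \<and> last u \<noteq> hd w" if "n \<ge> 1" for n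
      using that
    proof (induction n rule: nat_induct_at_least)
      case base
      obtain a where "a \<in> \<Omega>" "a \<noteq> hd w" using \<Omega> by blast
      then show ?case by (intro bexI[of _ "[a]"]) (auto simp: reduced_words_def)
    next
      case (Suc n)
      then obtain u where u: "u \<in> reduced_words \<Omega>" "length u = n" "u \<noteq> []" "last u \<noteq> hd w" by blast
      obtain a where "a \<in> \<Omega>" "a \<noteq> hd u" using \<Omega> by blast
      with u show ?case
        by (intro bexI[of _ "a # u"]) (auto simp: reduced_words_def distinct_adj_Cons)
    qed
    then obtain u where u: "u \<in> reduced_words \<Omega>" "length u = k" "last u \<noteq> hd w" using k by blast
    have uw: "u @ w \<in> reduced_words \<Omega>"
      using u w by (auto simp: reduced_words_def distinct_adj_append_iff)
    have "foldr cross u x \<in> ball_verts T x k"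
      using u ball_iff_word[OF x] by (auto simp: reduced_words_def)
    moreover have "g (foldr cross u x) = foldr cross (u @ w) x"
      using follow[of u] u w by (simp add: reduced_words_def)
    ultimately have "foldr cross (u @ w) x \<in> ball_verts T x k"
      using into by metis
    then obtain v where v: "set v \<subseteq> \<Omega>" "length v \<le> k" "foldr cross (u @ w) x = foldr cross v x"
      using ball_iff_word[OF x] by blast
    then have "u @ w = reduce v"
      using follow_eq_iff[OF x _ v(1), of "u @ w"] reduce_of_reduced[OF uw] uw
      by (auto simp: reduced_words_def)
    then have "length (u @ w) \<le> k" using length_reduce[of v] v(2) by simp
    then show False using u(2) ne by simp
  qed
  moreover obtain u where "set u \<subseteq> \<Omega>" "length u \<le> k" "y = foldr cross u x"
    using y ball_iff_word[OF x] by blast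
  ultimately show ?thesis using follow[of u] w(2) by simp
qed

lemma label_iso_unique:
  assumes x: "x \<in> pverts T" and k: "k \<ge> 1" and \<Omega>: "\<And>c. \<exists>a\<in>\<Omega>. a \<noteq> c"
    and f: "f \<in> label_isos (ball_graph T x k) l B m" and f': "f' \<in> label_isos (ball_graph T x k) l B m"
  shows "f = f'"
proof -
  let ?X = "ball_verts T x k"
  define g where "g y = inv_into ?X f' (f y)" for y
  have bij: "bij_betw f ?X (pverts B)" "bij_betw f' ?X (pverts B)"
    and ext: "f \<in> extensional ?X" "f' \<in> extensional ?X"
    and arcs: "\<And>u v. u \<in> ?X \<Longrightarrow> v \<in> ?X \<Longrightarrow> (u, v) \<in> parcs T \<longleftrightarrow> (f u, f v) \<in> parcs B"
      "\<And>u v. u \<in> ?X \<Longrightarrow> v \<in> ?X \<Longrightarrow> (u, v) \<in> parcs T \<longleftrightarrow> (f' u, f' v) \<in> parcs B"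
    and lab: "\<And>u v. (u, v) \<in> parcs T \<Longrightarrow> u \<in> ?X \<Longrightarrow> v \<in> ?X \<Longrightarrow> m (f u, f v) = l (u, v)"
      "\<And>u v. (u, v) \<in> parcs T \<Longrightarrow> u \<in> ?X \<Longrightarrow> v \<in> ?X \<Longrightarrow> m (f' u, f' v) = l (u, v)"
    using f f' unfolding label_isos_ball_iff by simp_all
  have gX: "g y \<in> ?X" and f'g: "f' (g y) = f y" if "y \<in> ?X" for y
  proof -
    have "f y \<in> f' ` ?X" using bij that by (auto simp: bij_betw_def)
    then show "g y \<in> ?X" "f' (g y) = f y"
      unfolding g_def by (rule inv_into_into, rule f_inv_into_f)
  qed
  have "g y = y" if "y \<in> ?X" for y
  proof (rule label_endomorphism_of_ball[OF x k \<Omega> gX _ that])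
    fix u v assume "(u, v) \<in> parcs (ball_graph T x k)"
    then have uv: "(u, v) \<in> parcs T" "u \<in> ?X" "v \<in> ?X" by (auto simp: ball_graph_def)
    then have "(f' (g u), f' (g v)) \<in> parcs B" using arcs(1) f'g by simp
    then have "(g u, g v) \<in> parcs T" using arcs(2) gX uv by simp
    then show "(g u, g v) \<in> parcs T \<and> l (g u, g v) = l (u, v)"
      using lab(1)[OF uv] lab(2)[of "g u" "g v"] gX f'g uv by simp
  qed
  then have "f y = f' y" if "y \<in> ?X" for y using f'g that by metis
  then show ?thesis using ext by (rule extensionalityI[rotated 2])
qed

end

text \<open>
  Both balls consist of the end points of words of length at most \<open>k\<close>, and whether two words have
  the same end point depends on the words alone. So sending end points to end points is well
  defined and injective.
\<close>

lemma label_iso_of_balls: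
  assumes "labelled_tree T \<Omega> l" "labelled_tree T' \<Omega> l'" and x: "x \<in> pverts T" "x' \<in> pverts T'"
  shows "label_isos (ball_graph T x k) l (ball_graph T' x' k) l' \<noteq> {}"
proof -
  interpret T: labelled_tree T \<Omega> l by fact
  interpret T': labelled_tree T' \<Omega> l' by fact
  let ?X = "ball_verts T x k" and ?X' = "ball_verts T' x' k"
  define f where
    "f = (\<lambda>y\<in>?X. foldr T'.cross (SOME w. set w \<subseteq> \<Omega> \<and> y = foldr T.cross w x) x')"
  have f: "f (foldr T.cross w x) = foldr T'.cross w x'"
    if "set w \<subseteq> \<Omega>" "foldr T.cross w x \<in> ?X" for w
  proof -
    define u where "u = (SOME u. set u \<subseteq> \<Omega> \<and> foldr T.cross w x = foldr T.cross u x)"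
    have "set u \<subseteq> \<Omega> \<and> foldr T.cross w x = foldr T.cross u x"
      unfolding u_def by (rule someI[of _ w]) (use that in simp)
    then have "foldr T'.cross u x' = foldr T'.cross w x'"
      using T.follow_eq_iff[OF x(1)] T'.follow_eq_iff[OF x(2)] that(1) by metis
    then show ?thesis using that(2) by (simp add: f_def u_def)
  qed
  have bij: "bij_betw f ?X ?X'"
    unfolding bij_betw_def
  proof
    show "inj_on f ?X"
    proof (rule inj_onI)
      fix y z assume yz: "y \<in> ?X" "z \<in> ?X" "f y = f z"
      obtain u w where "set u \<subseteq> \<Omega>" "y = foldr T.cross u x" "set w \<subseteq> \<Omega>" "z = foldr T.cross w x"
        using yz T.ball_iff_word[OF x(1)] by metis
      then show "y = z"
        using yz f[of u] f[of w] T.follow_eq_iff[OF x(1), of u w] T'.follow_eq_iff[OF x(2), of u w]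
        by simp
    qed
    show "f ` ?X = ?X'"
    proof (intro equalityI subsetI)
      fix z assume "z \<in> f ` ?X"
      then obtain y where y: "y \<in> ?X" "z = f y" by blast
      then obtain w where "set w \<subseteq> \<Omega>" "length w \<le> k" "y = foldr T.cross w x"
        unfolding T.ball_iff_word[OF x(1)] by blast
      then show "z \<in> ?X'" unfolding T'.ball_iff_word[OF x(2)] using f[of w] y by auto
    next
      fix z assume "z \<in> ?X'"
      then obtain w where w: "set w \<subseteq> \<Omega>" "length w \<le> k" "z = foldr T'.cross w x'"
        unfolding T'.ball_iff_word[OF x(2)] by blast
      then have "foldr T.cross w x \<in> ?X" unfolding T.ball_iff_word[OF x(1)] by blast
      then show "z \<in> f ` ?X" using f[OF w(1)] w(3) by (metis imageI)
    qed
  qed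
  have arcs: "((y, z) \<in> parcs T \<longleftrightarrow> (f y, f z) \<in> parcs T') \<and>
      ((y, z) \<in> parcs T \<longrightarrow> l' (f y, f z) = l (y, z))" if yz: "y \<in> ?X" "z \<in> ?X" for y z
  proof -
    obtain u w where u: "set u \<subseteq> \<Omega>" "y = foldr T.cross u x"
      and w: "set w \<subseteq> \<Omega>" "z = foldr T.cross w x"
      using yz T.ball_iff_word[OF x(1)] by metis
    have fy: "f y = foldr T'.cross u x'" and fz: "f z = foldr T'.cross w x'"
      using f u w yz by auto
    have yV: "y \<in> pverts T" "f y \<in> pverts T'"
      using u x fy T.follow_in_verts T'.follow_in_verts by auto
    have step: "T.cross a y = z \<longleftrightarrow> T'.cross a (f y) = f z" if "a \<in> \<Omega>" for a
      using T.follow_eq_iff[OF x(1), of "a # u" w] T'.follow_eq_iff[OF x(2), of "a # u" w]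
        that u w fy fz by auto
    have "(f y, f z) \<in> parcs T' \<and> l' (f y, f z) = l (y, z)" if "(y, z) \<in> parcs T"
      using step[of "l (y, z)"] T.cross_label[OF that] T'.cross_arc[OF yV(2), of "l (y, z)"] by simp
    moreover have "(y, z) \<in> parcs T" if "(f y, f z) \<in> parcs T'"
      using step[of "l' (f y, f z)"] T'.cross_label[OF that]
        T.cross_arc(1)[OF yV(1), of "l' (f y, f z)"] by simp
    ultimately show ?thesis by blast
  qed
  have "f \<in> label_isos (ball_graph T x k) l (ball_graph T' x' k) l'"
    unfolding label_isos_ball_iff using bij arcs bij_betwE[OF bij]
    by (simp add: ball_graph_def f_def)
  then show ?thesis by blast
qed

lemma compose_label_isos:
  assumes f: "f \<in> label_isos G l G' l'" and g: "g \<in> label_isos G' l' G'' l''"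
    and G: "parcs G \<subseteq> pverts G \<times> pverts G"
  shows "compose (pverts G) g f \<in> label_isos G l G'' l''"
proof -
  have bij: "bij_betw f (pverts G) (pverts G')" "bij_betw g (pverts G') (pverts G'')"
    using f g by (auto simp: label_isos_def graph_isos_def)
  have fV: "\<And>y. y \<in> pverts G \<Longrightarrow> f y \<in> pverts G'" using bij(1) by (auto simp: bij_betw_def)
  have "bij_betw (compose (pverts G) g f) (pverts G) (pverts G'')"
    using bij by (rule bij_betw_compose)
  moreover have "((x, y) \<in> parcs G \<longleftrightarrow> (g (f x), g (f y)) \<in> parcs G'')"
    if "x \<in> pverts G" "y \<in> pverts G" for x y
    using f g fV that by (auto simp: label_isos_def graph_isos_def)
  moreover have "l'' (g (f x), g (f y)) = l (x, y)" if xy: "(x, y) \<in> parcs G" for x y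
  proof -
    have "x \<in> pverts G" "y \<in> pverts G" using G xy by auto
    then have "(f x, f y) \<in> parcs G'" using f xy by (auto simp: label_isos_def graph_isos_def)
    then show ?thesis using f g xy by (fastforce simp: label_isos_def)
  qed
  ultimately show ?thesis
    using G by (auto simp: label_isos_def graph_isos_def compose_def)
qed

section \<open>A labelling from involutive inversions\<close>

text \<open>
  The involutions \<open>t a\<close> invert the edges at \<open>b\<close>, one each. The walk through the translates of \<open>b\<close>
  under the prefixes of a reduced word never backtracks, so the involutions generate a group that
  acts simply transitively on the vertices. Giving the edge from \<open>b\<close> to \<open>t a b\<close> the label \<open>a\<close> and
  translating it by the group is then a consistent labelling; edge inversion preserves it because
  \<open>t a\<close> swaps \<open>b\<close> and \<open>t a b\<close>.
\<close>

lemma labelling_from_involutions: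
  assumes tree: "serre_tree T" and b: "b \<in> pverts T"
    and inv: "involutions_on (pverts T) \<Omega> t"
    and arcs: "\<And>a x y. a \<in> \<Omega> \<Longrightarrow> (x, y) \<in> parcs T \<Longrightarrow> (t a x, t a y) \<in> parcs T"
    and bij: "bij_betw (\<lambda>a. t a b) \<Omega> {u. (b, u) \<in> parcs T}"
  shows "\<exists>l. labelling T \<Omega> l \<and>
      (\<forall>a\<in>\<Omega>. \<forall>(x, y)\<in>parcs T. l (t a x, t a y) = l (x, y)) \<and>
      (\<forall>y\<in>pverts T. \<exists>w. set w \<subseteq> \<Omega> \<and> y = foldr t w b)"
proof -
  have word_arcs: "(foldr t w x, foldr t w y) \<in> parcs T" if "set w \<subseteq> \<Omega>" "(x, y) \<in> parcs T" for w x y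
    using that by (induction w) (auto intro: arcs)
  have word_inj: "x = y" if "set w \<subseteq> \<Omega>" "x \<in> pverts T" "y \<in> pverts T" "foldr t w x = foldr t w y"
    for w x y using foldr_rev_foldr[OF inv that(1)] that by metis
  have nbr: "(b, t a b) \<in> parcs T" if "a \<in> \<Omega>" for a
    using bij_betwE[OF bij] that by auto
  have tV: "t a b \<in> pverts T" if "a \<in> \<Omega>" for a
    using serre_treeD(2)[OF tree nbr[OF that]] .
  have t_inj: "a = c" if "a \<in> \<Omega>" "c \<in> \<Omega>" "t a b = t c b" for a c
    using inj_onD[OF bij_betw_imp_inj_on[OF bij]] that by blast
  have free: "acts_freely_at \<Omega> t b"
    unfolding acts_freely_at_def
  proof (intro ballI impI)
    fix w assume w: "w \<in> reduced_words \<Omega>" "w \<noteq> []"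
    define f where "f i = foldr t (take i w) b" for i
    have w\<Omega>: "set w \<subseteq> \<Omega>" using w by (simp add: reduced_words_def)
    have tk: "set (take i w) \<subseteq> \<Omega>" for i using w\<Omega> by (auto dest: in_set_takeD)
    have in\<Omega>: "w ! i \<in> \<Omega>" if "i < length w" for i using w\<Omega> that by auto
    have Suc_f: "f (Suc i) = foldr t (take i w) (t (w ! i) b)" if "i < length w" for i
      using that by (simp add: f_def take_Suc_conv_app_nth)
    have "f 0 \<noteq> f (length w)"
    proof (rule nonbacktracking_walk_not_closed[OF tree])
      show "(f i, f (Suc i)) \<in> parcs T" if "i < length w" for i
        unfolding Suc_f[OF that] unfolding f_def by (rule word_arcs[OF tk nbr[OF in\<Omega>[OF that]]])
      fix i assume i: "Suc (Suc i) \<le> length w"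
      let ?a = "w ! i" and ?c = "w ! Suc i"
      have ac: "?a \<in> \<Omega>" "?c \<in> \<Omega>" using i by (auto intro: in\<Omega>)
      have "?a \<noteq> ?c" using distinct_adj_nth[of w i] w i by (simp add: reduced_words_def)
      have tac: "t ?a (t ?c b) \<in> pverts T" using involutions_onD(1)[OF inv ac(1) tV[OF ac(2)]] .
      have "f (Suc (Suc i)) = foldr t (take i w) (t ?a (t ?c b))"
        using i by (simp add: f_def take_Suc_conv_app_nth)
      moreover have "t ?a (t ?c b) \<noteq> b"
        using \<open>?a \<noteq> ?c\<close> t_inj[OF ac] involutions_onD(2)[OF inv ac(1) tV[OF ac(2)]] by auto
      ultimately show "f i \<noteq> f (Suc (Suc i))"
        using word_inj[OF tk b tac] unfolding f_def by metis
    qed (use w in simp)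
    then show "foldr t w b \<noteq> b" by (simp add: f_def)
  qed
  have same_word: "foldr t u v = foldr t w v"
    if "set u \<subseteq> \<Omega>" "set w \<subseteq> \<Omega>" "foldr t u b = foldr t w b" "v \<in> pverts T" for u w v
    using foldr_eq_iff_reduce_eq[OF inv b free that(1,2)] that(3)
      foldr_reduce[OF inv that(1,4)] foldr_reduce[OF inv that(2,4)] by simp
  \<comment> \<open>E x y a: the edge from x to y is a translate of the one from b to t a b\<close>
  define E where "E x y a \<longleftrightarrow> a \<in> \<Omega> \<and>
    (\<exists>w. set w \<subseteq> \<Omega> \<and> x = foldr t w b \<and> y = foldr t w (t a b))" for x y a
  have E_nbr: "\<exists>a. E x y a" if w: "set w \<subseteq> \<Omega>" "x = foldr t w b" and xy: "(x, y) \<in> parcs T" for w x y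
  proof -
    have "(b, foldr t (rev w) y) \<in> parcs T"
      using word_arcs[of "rev w" x y] w xy foldr_rev_foldr[OF inv w(1) b] by simp
    then obtain a where a: "a \<in> \<Omega>" "foldr t (rev w) y = t a b"
      using bij unfolding bij_betw_def by blast
    then have "y = foldr t w (t a b)"
      using foldr_foldr_rev[OF inv w(1) serre_treeD(2)[OF tree xy]] by simp
    then show ?thesis using a(1) w unfolding E_def by blast
  qed
  have transitive: "\<exists>w. set w \<subseteq> \<Omega> \<and> y = foldr t w b" if "y \<in> pverts T" for y
    using serre_treeD(5)[OF tree b that]
  proof (induction rule: rtrancl_induct)
    case base
    show ?case by (intro exI[of _ "[]"]) simp
  next
    case (step x y)
    then obtain a where "E x y a" using E_nbr by blast
    then obtain w where "a \<in> \<Omega>" "set w \<subseteq> \<Omega>" "y = foldr t w (t a b)" by (auto simp: E_def)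
    then show ?case by (intro exI[of _ "w @ [a]"]) simp
  qed
  have E_ex: "\<exists>a. E x y a" if "(x, y) \<in> parcs T" for x y
    using E_nbr transitive serre_treeD(1)[OF tree that] that by blast
  have E_unique: "a = c" if E: "E x y a" "E x y c" for x y a c
  proof -
    obtain u where a: "a \<in> \<Omega>" and u: "set u \<subseteq> \<Omega>" "x = foldr t u b" "y = foldr t u (t a b)"
      using E(1) unfolding E_def by blast
    obtain w where c: "c \<in> \<Omega>" and w: "set w \<subseteq> \<Omega>" "x = foldr t w b" "y = foldr t w (t c b)"
      using E(2) unfolding E_def by blast
    have "foldr t u (t a b) = foldr t u (t c b)"
      using same_word[OF u(1) w(1) _ tV[OF c]] u w by simp
    then show ?thesis using word_inj[OF u(1) tV[OF a] tV[OF c]] t_inj[OF a c] by blast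
  qed
  have E_target: "y = z" if E: "E x y a" "E x z a" for x y z a
  proof -
    obtain u where a: "a \<in> \<Omega>" and u: "set u \<subseteq> \<Omega>" "x = foldr t u b" "y = foldr t u (t a b)"
      using E(1) unfolding E_def by blast
    obtain w where w: "set w \<subseteq> \<Omega>" "x = foldr t w b" "z = foldr t w (t a b)"
      using E(2) unfolding E_def by blast
    with u show ?thesis using same_word[OF u(1) w(1) _ tV[OF a]] by simp
  qed
  have E_sym: "E y x a" if E: "E x y a" for x y a
  proof -
    obtain w where a: "a \<in> \<Omega>" and w: "set w \<subseteq> \<Omega>" "x = foldr t w b" "y = foldr t w (t a b)"
      using E unfolding E_def by blast
    then show ?thesis
      unfolding E_def using involutions_onD(2)[OF inv a b] by (intro conjI exI[of _ "w @ [a]"]) auto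
  qed
  have E_act: "E (t c x) (t c y) a" if E: "E x y a" and c: "c \<in> \<Omega>" for c x y a
  proof -
    obtain w where a: "a \<in> \<Omega>" and w: "set w \<subseteq> \<Omega>" "x = foldr t w b" "y = foldr t w (t a b)"
      using E unfolding E_def by blast
    then show ?thesis
      unfolding E_def using c by (intro conjI exI[of _ "c # w"]) auto
  qed
  define l where "l e = (THE a. E (fst e) (snd e) a)" for e
  have l: "l (x, y) = a" if "E x y a" for x y a
    unfolding l_def using that E_unique by auto
  have "bij_betw l (out_arcs (with_proj T) x) \<Omega>" if x: "x \<in> pverts T" for x
    unfolding bij_betw_def
  proof
    show "inj_on l (out_arcs (with_proj T) x)"
    proof (rule inj_onI)
      fix e e' assume e: "e \<in> out_arcs (with_proj T) x" "e' \<in> out_arcs (with_proj T) x" "l e = l e'"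
      then obtain y z where yz: "e = (x, y)" "e' = (x, z)" "(x, y) \<in> parcs T" "(x, z) \<in> parcs T"
        by (cases e, cases e') auto
      obtain a c where ac: "E x y a" "E x z c" using E_ex yz by blast
      then have "a = c" using l e(3) yz by metis
      then show "e = e'" using E_target ac yz by blast
    qed
    show "l ` out_arcs (with_proj T) x = \<Omega>"
    proof (intro equalityI subsetI)
      fix c assume "c \<in> l ` out_arcs (with_proj T) x"
      then obtain y where y: "(x, y) \<in> parcs T" "c = l (x, y)" by auto
      then obtain a where "E x y a" using E_ex by blast
      then show "c \<in> \<Omega>" using l y(2) by (auto simp: E_def)
    next
      fix a assume a: "a \<in> \<Omega>"
      obtain w where w: "set w \<subseteq> \<Omega>" "x = foldr t w b" using transitive x by blast
      have "E x (foldr t w (t a b)) a" unfolding E_def using a w by blast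
      moreover have "(x, foldr t w (t a b)) \<in> parcs T"
        unfolding w(2) by (rule word_arcs[OF w(1) nbr[OF a]])
      ultimately show "a \<in> l ` out_arcs (with_proj T) x"
        using l by (intro image_eqI[of _ _ "(x, foldr t w (t a b))"]) auto
    qed
  qed
  moreover have "l (x, y) = l (y, x)" if "(x, y) \<in> parcs T" for x y
    using E_ex[OF that] E_sym l by metis
  ultimately have "labelling T \<Omega> l" by (auto simp: labelling_def)
  moreover have "l (t a x, t a y) = l (x, y)" if "a \<in> \<Omega>" "(x, y) \<in> parcs T" for a x y
    using E_ex[OF that(2)] E_act[OF _ that(1)] l by metis
  ultimately show ?thesis using transitive by blast
qed

lemma graph_isosD:
  assumes "f \<in> graph_isos G G'"
  shows "f \<in> extensional (pverts G)" "bij_betw f (pverts G) (pverts G')"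
    "x \<in> pverts G \<Longrightarrow> f x \<in> pverts G'"
    "x \<in> pverts G \<Longrightarrow> y \<in> pverts G \<Longrightarrow> (f x, f y) \<in> parcs G' \<longleftrightarrow> (x, y) \<in> parcs G"
  using assms by (auto simp: graph_isos_def dest: bij_betwE)

lemma Aut_simps:
  shows carrier_Aut: "carrier (Aut G) = graph_isos G G"
    and one_Aut: "\<one>\<^bsub>Aut G\<^esub> = (\<lambda>x\<in>pverts G. x)"
    and mult_Aut: "f \<in> graph_isos G G \<Longrightarrow> g \<in> graph_isos G G \<Longrightarrow>
      f \<otimes>\<^bsub>Aut G\<^esub> g = compose (pverts G) f g"
  by (auto simp: Aut_def BijGroup_def Bij_def graph_isos_def)

lemma subgroup_AutD:
  assumes H: "subgroup H (Aut G)"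
  shows "f \<in> H \<Longrightarrow> f \<in> graph_isos G G" "(\<lambda>x\<in>pverts G. x) \<in> H"
    "f \<in> H \<Longrightarrow> g \<in> H \<Longrightarrow> compose (pverts G) f g \<in> H"
    "f \<in> H \<Longrightarrow> \<exists>g\<in>H. \<forall>x\<in>pverts G. g x \<in> pverts G \<and> g (f x) = x \<and> f (g x) = x"
proof -
  show sub: "f \<in> H \<Longrightarrow> f \<in> graph_isos G G" for f
    using subgroup.subset[OF H] by (auto simp: carrier_Aut)
  show "(\<lambda>x\<in>pverts G. x) \<in> H" using subgroup.one_closed[OF H] by (simp add: one_Aut)
  show "f \<in> H \<Longrightarrow> g \<in> H \<Longrightarrow> compose (pverts G) f g \<in> H"
    using subgroup.m_closed[OF H, of f g] mult_Aut sub by metis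
  assume f: "f \<in> H"
  let ?g = "inv\<^bsub>Aut G\<^esub> f"
  have g: "?g \<in> H" using subgroup.m_inv_closed[OF H f] .
  have "compose (pverts G) ?g f = (\<lambda>x\<in>pverts G. x)" "compose (pverts G) f ?g = (\<lambda>x\<in>pverts G. x)"
    using group.l_inv[OF group_Aut, of f G] group.r_inv[OF group_Aut, of f G] sub f g
    by (simp_all add: carrier_Aut one_Aut mult_Aut)
  then have "?g (f x) = x \<and> f (?g x) = x" if "x \<in> pverts G" for x
    using that by (metis compose_eq restrict_apply')
  then show "\<exists>g\<in>H. \<forall>x\<in>pverts G. g x \<in> pverts G \<and> g (f x) = x \<and> f (g x) = x"
    using g graph_isosD(3)[OF sub[OF g]] by blast
qed

text \<open>
  Conjugating the given inversion \<open>\<tau>\<close> of an edge at \<open>b\<close> by elements of the stabilizer of \<open>b\<close> yields,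
  by local transitivity, an involution in \<open>H\<close> inverting any prescribed edge at \<open>b\<close>.
\<close>

lemma vertex_transitive_labelling:
  assumes T: "regular_tree d T" and d: "d \<ge> 1" "card \<Omega> = d"
    and H: "subgroup H (Aut T)" and loc: "locally_transitive T H"
    and \<tau>: "\<tau> \<in> H" "involutive_inversion T \<tau>"
  shows "\<exists>l. labelling T \<Omega> l \<and> (\<forall>y\<in>pverts T. \<forall>z\<in>pverts T.
      \<exists>\<gamma>\<in>H. \<gamma> y = z \<and> (\<forall>(u, v)\<in>parcs T. l (\<gamma> u, \<gamma> v) = l (u, v)))"
proof -
  have tree: "serre_tree T" using T by (simp add: regular_tree_def)
  obtain b v where bv: "(b, v) \<in> parcs T" "\<tau> b = v" "\<tau> v = b"
    using \<tau>(2) by (auto simp: involutive_inversion_def inversion_def)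
  have b: "b \<in> pverts T" using serre_treeD(1)[OF tree bv(1)] .
  have \<tau>_iso: "\<tau> \<in> graph_isos T T" using subgroup_AutD(1)[OF H \<tau>(1)] .
  interpret Aut: group "Aut T" by (rule group_Aut)
  have "\<tau> [^]\<^bsub>Aut T\<^esub> (2::nat) = \<one>\<^bsub>Aut T\<^esub>"
    using Aut.pow_ord_eq_1[of \<tau>] \<tau>(2) \<tau>_iso
    unfolding involutive_inversion_def carrier_Aut by metis
  then have "compose (pverts T) \<tau> \<tau> = (\<lambda>x\<in>pverts T. x)"
    using \<tau>_iso Aut.l_one[of \<tau>] by (simp add: numeral_2_eq_2 carrier_Aut one_Aut mult_Aut)
  then have \<tau>\<tau>: "\<tau> (\<tau> x) = x" if "x \<in> pverts T" for x
    using that by (metis compose_eq restrict_apply')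
  have "card (out_arcs (with_proj T) b) = d"
    using T b by (simp add: regular_tree_def out_degree_def)
  then have "finite \<Omega>" "finite (out_arcs (with_proj T) b)" "card \<Omega> = card (out_arcs (with_proj T) b)"
    using d by (auto intro!: card_ge_0_finite)
  then obtain \<beta> where \<beta>: "bij_betw \<beta> \<Omega> (out_arcs (with_proj T) b)"
    using finite_same_card_bij by blast
  have \<beta>_arc: "\<beta> a \<in> parcs T" "fst (\<beta> a) = b" if "a \<in> \<Omega>" for a
    using bij_betwE[OF \<beta>] that by auto
  have "\<exists>s\<in>H. s b = snd (\<beta> a) \<and> (\<forall>x\<in>pverts T. s (s x) = x)" if a: "a \<in> \<Omega>" for a
  proof -
    obtain h where h: "h \<in> H" "h b = b" "h v = snd (\<beta> a)"
    proof -
      have "(b, v) \<in> out_arcs (with_proj T) b" "\<beta> a \<in> out_arcs (with_proj T) b"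
        using bv(1) \<beta>_arc[OF a] by simp_all
      then obtain h where "h \<in> H" "h b = b" "map_prod h h (b, v) = \<beta> a"
        using loc b unfolding locally_transitive_def by blast
      then show thesis using that by (metis map_prod_simp snd_conv)
    qed
    obtain h' where h': "h' \<in> H" "\<And>x. x \<in> pverts T \<Longrightarrow> h' x \<in> pverts T \<and> h' (h x) = x \<and> h (h' x) = x"
      using subgroup_AutD(4)[OF H h(1)] by blast
    let ?s = "compose (pverts T) h (compose (pverts T) \<tau> h')"
    have s: "?s x = h (\<tau> (h' x))" "?s x \<in> pverts T" if "x \<in> pverts T" for x
      using that h' graph_isosD(3)[OF subgroup_AutD(1)[OF H h(1)]] graph_isosD(3)[OF \<tau>_iso]
      by (simp_all add: compose_eq)
    have "?s (?s x) = x" if x: "x \<in> pverts T" for x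
    proof -
      have "\<tau> (h' x) \<in> pverts T" using h'(2)[OF x] graph_isosD(3)[OF \<tau>_iso] by blast
      then show ?thesis
        using s(1)[OF s(2)[OF x]] s(1)[OF x] h'(2) \<tau>\<tau> x by simp
    qed
    moreover have "?s b = snd (\<beta> a)"
      using s(1)[OF b] h'(2)[OF b] h bv by simp
    moreover have "?s \<in> H" using subgroup_AutD(3)[OF H] h h' \<tau> by blast
    ultimately show ?thesis by blast
  qed
  then obtain t where t: "\<And>a. a \<in> \<Omega> \<Longrightarrow> t a \<in> H" "\<And>a. a \<in> \<Omega> \<Longrightarrow> t a b = snd (\<beta> a)"
      "\<And>a x. a \<in> \<Omega> \<Longrightarrow> x \<in> pverts T \<Longrightarrow> t a (t a x) = x"
    by metis
  note t_iso = subgroup_AutD(1)[OF H t(1)]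
  have inv: "involutions_on (pverts T) \<Omega> t"
    using t(3) graph_isosD(3)[OF t_iso] by (simp add: involutions_on_def)
  have arcs: "(t a x, t a y) \<in> parcs T" if "a \<in> \<Omega>" "(x, y) \<in> parcs T" for a x y
    using graph_isosD(4)[OF t_iso[OF that(1)]] serre_treeD(1,2)[OF tree that(2)] that by blast
  have "bij_betw snd (out_arcs (with_proj T) b) {u. (b, u) \<in> parcs T}"
    by (rule bij_betwI[of _ _ _ "Pair b"]) auto
  then have "bij_betw (snd \<circ> \<beta>) \<Omega> {u. (b, u) \<in> parcs T}" using \<beta> by (rule bij_betw_trans[rotated])
  then have "bij_betw (\<lambda>a. t a b) \<Omega> {u. (b, u) \<in> parcs T}"
    by (rule bij_betw_cong[THEN iffD1, rotated]) (simp add: t(2))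
  from labelling_from_involutions[OF tree b inv arcs this] obtain l where
    l: "labelling T \<Omega> l" "\<And>a x y. a \<in> \<Omega> \<Longrightarrow> (x, y) \<in> parcs T \<Longrightarrow> l (t a x, t a y) = l (x, y)"
    and transitive: "\<And>y. y \<in> pverts T \<Longrightarrow> \<exists>w. set w \<subseteq> \<Omega> \<and> y = foldr t w b"
    by blast
  have word_in_H: "\<exists>\<gamma>\<in>H. \<forall>x\<in>pverts T. \<gamma> x = foldr t w x" if "set w \<subseteq> \<Omega>" for w
    using that
  proof (induction w)
    case Nil
    show ?case using subgroup_AutD(2)[OF H] by (intro bexI[of _ "\<lambda>x\<in>pverts T. x"]) auto
  next
    case (Cons a w)
    then obtain \<gamma> where "\<gamma> \<in> H" "\<forall>x\<in>pverts T. \<gamma> x = foldr t w x" by auto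
    then show ?case using subgroup_AutD(3)[OF H t(1)[of a]] Cons.prems
      by (intro bexI[of _ "compose (pverts T) (t a) \<gamma>"]) (auto simp: compose_eq)
  qed
  have word_label: "(foldr t w x, foldr t w y) \<in> parcs T \<and> l (foldr t w x, foldr t w y) = l (x, y)"
    if "set w \<subseteq> \<Omega>" "(x, y) \<in> parcs T" for w x y
    using that by (induction w) (auto simp: arcs l(2))
  have "\<exists>\<gamma>\<in>H. \<gamma> y = z \<and> (\<forall>(u, v)\<in>parcs T. l (\<gamma> u, \<gamma> v) = l (u, v))"
    if y: "y \<in> pverts T" and z: "z \<in> pverts T" for y z
  proof -
    obtain u w where u: "set u \<subseteq> \<Omega>" "y = foldr t u b" and w: "set w \<subseteq> \<Omega>" "z = foldr t w b"
      using transitive y z by blast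
    have uw: "set (w @ rev u) \<subseteq> \<Omega>" using u w by auto
    then obtain \<gamma> where \<gamma>: "\<gamma> \<in> H" "\<And>x. x \<in> pverts T \<Longrightarrow> \<gamma> x = foldr t (w @ rev u) x"
      using word_in_H by blast
    have "\<gamma> y = z" using \<gamma>(2)[OF y] foldr_rev_foldr[OF inv u(1) b] u w by simp
    moreover have "l (\<gamma> x, \<gamma> x') = l (x, x')" if "(x, x') \<in> parcs T" for x x'
      using word_label[OF uw that] \<gamma>(2) serre_treeD(1,2)[OF tree that] by simp
    ultimately show ?thesis using \<gamma>(1) by blast
  qed
  then show ?thesis using l(1) by blast
qed

section \<open>Local actions\<close>

lemma graph_iso_image_ball:
  assumes tree: "serre_tree T" and g: "g \<in> graph_isos T T" and x: "x \<in> pverts T"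
  shows "g ` ball_verts T x k = ball_verts T (g x) k"
proof -
  have relpow: "(g x, z) \<in> parcs T ^^ n \<longleftrightarrow> (\<exists>y\<in>pverts T. (x, y) \<in> parcs T ^^ n \<and> z = g y)" for n z
  proof (induction n arbitrary: z)
    case 0
    show ?case using x by auto
  next
    case (Suc n)
    show ?case
    proof
      assume "(g x, z) \<in> parcs T ^^ Suc n"
      then obtain y where y: "y \<in> pverts T" "(x, y) \<in> parcs T ^^ n" "(g y, z) \<in> parcs T"
        using Suc by auto
      then have "z \<in> g ` pverts T"
        using serre_treeD(2)[OF tree y(3)] graph_isosD(2)[OF g] by (simp add: bij_betw_def)
      then obtain y' where "y' \<in> pverts T" "z = g y'" by blast
      then show "\<exists>y\<in>pverts T. (x, y) \<in> parcs T ^^ Suc n \<and> z = g y"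
        using graph_isosD(4)[OF g y(1)] y by (intro bexI[of _ y']) auto
    next
      assume "\<exists>y\<in>pverts T. (x, y) \<in> parcs T ^^ Suc n \<and> z = g y"
      then obtain y y' where y: "(x, y) \<in> parcs T ^^ n" "(y, y') \<in> parcs T" "z = g y'" by auto
      then have "(g y, z) \<in> parcs T" "y \<in> pverts T"
        using graph_isosD(4)[OF g] serre_treeD(1,2)[OF tree y(2)] by auto
      then show "(g x, z) \<in> parcs T ^^ Suc n" using Suc[of "g y"] y by auto
    qed
  qed
  show ?thesis
  proof (intro equalityI subsetI)
    fix z assume "z \<in> g ` ball_verts T x k"
    then obtain y where "y \<in> ball_verts T x k" "z = g y" by blast
    then show "z \<in> ball_verts T (g x) k"
      using relpow ball_verts_subset[OF tree x] graph_isosD(3)[OF g x]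
      unfolding ball_verts_relpow[OF tree x] ball_verts_relpow[OF tree graph_isosD(3)[OF g x]]
      by (metis (no_types, lifting) \<open>y \<in> ball_verts T x k\<close> subsetD)
  next
    fix z assume "z \<in> ball_verts T (g x) k"
    then obtain n where "n \<le> k" "(g x, z) \<in> parcs T ^^ n"
      unfolding ball_verts_relpow[OF tree graph_isosD(3)[OF g x]] by blast
    then obtain y where "(x, y) \<in> parcs T ^^ n" "z = g y" using relpow by blast
    with \<open>n \<le> k\<close> show "z \<in> g ` ball_verts T x k"
      using ball_verts_relpow[OF tree x] by blast
  qed
qed

text \<open>
  The two facts about balls, existence and uniqueness of label-respecting isomorphisms onto the
  model, are what gives \<open>ball_label\<close> and \<open>local_action\<close> their meaning.
\<close>

locale labelled_tree_with_model = labelled_tree T \<Omega> l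
  for T :: "'v pair_pre_digraph" and \<Omega> :: "'o set" and l :: "'v \<times> 'v \<Rightarrow> 'o" +
  fixes k :: nat and B :: "'b pair_pre_digraph" and m :: "'b \<times> 'b \<Rightarrow> 'o"
  assumes radius: "k \<ge> 1" and two_labels: "\<And>c. \<exists>a\<in>\<Omega>. a \<noteq> c"
    and model: "\<And>x. x \<in> pverts T \<Longrightarrow> label_isos (ball_graph T x k) l B m \<noteq> {}"
begin

abbreviation "ball x \<equiv> ball_verts T x k"
abbreviation "\<Lambda> \<equiv> ball_label T l k B m"
abbreviation "\<sigma> \<equiv> local_action T l k B m"

lemma ball_label_eqI:
  assumes "x \<in> pverts T" "f \<in> label_isos (ball_graph T x k) l B m"
  shows "\<Lambda> x = f"
  unfolding ball_label_def
  using assms label_iso_unique[OF assms(1) radius two_labels] by (intro the_equality) blast+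

lemma ball_label_iso:
  assumes "x \<in> pverts T"
  shows "\<Lambda> x \<in> label_isos (ball_graph T x k) l B m"
  using model[OF assms] ball_label_eqI[OF assms] by blast

lemma ball_label_bij: "x \<in> pverts T \<Longrightarrow> bij_betw (\<Lambda> x) (ball x) (pverts B)"
  using ball_label_iso[of x] by (simp add: label_isos_ball_iff)

lemma ball_label_inj:
  "x \<in> pverts T \<Longrightarrow> y \<in> ball x \<Longrightarrow> z \<in> ball x \<Longrightarrow> \<Lambda> x y = \<Lambda> x z \<Longrightarrow> y = z"
  using ball_label_bij[of x] by (auto simp: bij_betw_def dest: inj_onD)

lemma local_action_apply:
  assumes "x \<in> pverts T" "y \<in> ball x"
  shows "\<sigma> g x (\<Lambda> x y) = \<Lambda> (g x) (g y)"
  using bij_betw_inv_into_left[OF ball_label_bij[OF assms(1)] assms(2)]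
    bij_betw_apply[OF ball_label_bij[OF assms(1)] assms(2)] by (simp add: local_action_def)

lemma local_action_eqI:
  assumes x: "x \<in> pverts T" and \<phi>: "\<phi> \<in> extensional (pverts B)"
    and eq: "\<And>y. y \<in> ball x \<Longrightarrow> \<phi> (\<Lambda> x y) = \<Lambda> (g x) (g y)"
  shows "\<sigma> g x = \<phi>"
proof (rule extensionalityI[OF _ \<phi>])
  show "\<sigma> g x \<in> extensional (pverts B)" by (simp add: local_action_def)
  fix b assume "b \<in> pverts B"
  then obtain y where "y \<in> ball x" "b = \<Lambda> x y"
    using ball_label_bij[OF x] by (auto simp: bij_betw_def)
  then show "\<sigma> g x b = \<phi> b" using eq local_action_apply[OF x] by simp
qed

lemma local_action_cong:
  assumes x: "x \<in> pverts T" and eq: "restrict g (ball x) = restrict h (ball x)"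
  shows "\<sigma> g x = \<sigma> h x"
proof (rule local_action_eqI[OF x])
  have gh: "g y = h y" if "y \<in> ball x" for y using eq that by (metis restrict_apply')
  show "\<sigma> h x (\<Lambda> x y) = \<Lambda> (g x) (g y)" if "y \<in> ball x" for y
    using local_action_apply[OF x that] gh[OF that] gh[OF centre_in_ball[OF tree x]] by simp
qed (simp add: local_action_def)

lemma iso_in_ball:
  "g \<in> graph_isos T T \<Longrightarrow> x \<in> pverts T \<Longrightarrow> y \<in> ball x \<Longrightarrow> g y \<in> ball (g x)"
  using graph_iso_image_ball[OF tree] by blast

lemma in_ball_in_verts: "x \<in> pverts T \<Longrightarrow> y \<in> ball x \<Longrightarrow> y \<in> pverts T"
  using ball_verts_subset[OF tree] by blast

text \<open>
  This cocycle identity turns products of automorphisms of the tree into products of automorphisms of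
  the model, but with local actions taken at two different vertices.
\<close>

lemma local_action_compose:
  assumes g: "g \<in> graph_isos T T" and h: "h \<in> graph_isos T T" and x: "x \<in> pverts T"
  shows "\<sigma> (compose (pverts T) g h) x = compose (pverts B) (\<sigma> g (h x)) (\<sigma> h x)"
proof (rule local_action_eqI[OF x compose_extensional])
  fix y assume y: "y \<in> ball x"
  have hx: "h x \<in> pverts T" using graph_isosD(3)[OF h x] .
  have "\<Lambda> x y \<in> pverts B" using bij_betw_apply[OF ball_label_bij[OF x] y] .
  then show "compose (pverts B) (\<sigma> g (h x)) (\<sigma> h x) (\<Lambda> x y) =
      \<Lambda> (compose (pverts T) g h x) (compose (pverts T) g h y)"
    using x in_ball_in_verts[OF x y]
    by (simp add: compose_eq local_action_apply x y local_action_apply[OF hx iso_in_ball[OF h x y]])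
qed

text \<open>
  Both sides, as functions of \<open>y\<close>, are label-respecting isomorphisms from the ball around \<open>x\<close> to the
  model, and there is only one. In other words, the local actions of \<open>\<gamma>\<close> are trivial.
\<close>

lemma local_action_label_preserving:
  assumes \<gamma>: "\<gamma> \<in> graph_isos T T" and lab: "\<And>u v. (u, v) \<in> parcs T \<Longrightarrow> l (\<gamma> u, \<gamma> v) = l (u, v)"
    and x: "x \<in> pverts T" and y: "y \<in> ball x"
  shows "\<Lambda> (\<gamma> x) (\<gamma> y) = \<Lambda> x y"
proof -
  have \<gamma>x: "\<gamma> x \<in> pverts T" using graph_isosD(3)[OF \<gamma> x] .
  let ?f = "compose (ball x) (\<Lambda> (\<gamma> x)) \<gamma>"
  have "inj_on \<gamma> (ball x)"
    using graph_isosD(2)[OF \<gamma>] ball_verts_subset[OF tree x] by (auto simp: bij_betw_def intro: inj_on_subset)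
  then have "bij_betw \<gamma> (ball x) (ball (\<gamma> x))"
    using graph_iso_image_ball[OF tree \<gamma> x] by (simp add: bij_betw_def)
  then have "bij_betw ?f (ball x) (pverts B)"
    using ball_label_bij[OF \<gamma>x] by (rule bij_betw_compose)
  moreover have "((u, v) \<in> parcs T \<longleftrightarrow> (\<Lambda> (\<gamma> x) (\<gamma> u), \<Lambda> (\<gamma> x) (\<gamma> v)) \<in> parcs B) \<and>
      ((u, v) \<in> parcs T \<longrightarrow> m (\<Lambda> (\<gamma> x) (\<gamma> u), \<Lambda> (\<gamma> x) (\<gamma> v)) = l (u, v))"
    if uv: "u \<in> ball x" "v \<in> ball x" for u v
  proof -
    have "(\<gamma> u, \<gamma> v) \<in> parcs T \<longleftrightarrow> (u, v) \<in> parcs T"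
      using graph_isosD(4)[OF \<gamma>] in_ball_in_verts[OF x] uv by blast
    then show ?thesis
      using ball_label_iso[OF \<gamma>x] iso_in_ball[OF \<gamma> x] uv lab by (simp add: label_isos_ball_iff)
  qed
  ultimately have "?f \<in> label_isos (ball_graph T x k) l B m"
    by (simp add: label_isos_ball_iff compose_eq)
  then have "\<Lambda> x = ?f" by (rule ball_label_eqI[OF x])
  then show ?thesis using y by (simp add: compose_eq)
qed

lemma local_action_in_Aut:
  assumes g: "g \<in> graph_isos T T" and x: "x \<in> pverts T"
  shows "\<sigma> g x \<in> graph_isos B B"
proof -
  have gx: "g x \<in> pverts T" using graph_isosD(3)[OF g x] .
  let ?L = "\<Lambda> x" and ?L' = "\<Lambda> (g x)"
  have surj: "\<exists>y\<in>ball x. b = ?L y" if "b \<in> pverts B" for b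
    using ball_label_bij[OF x] that by (auto simp: bij_betw_def)
  have "bij_betw (\<sigma> g x) (pverts B) (pverts B)"
    unfolding bij_betw_def
  proof
    show "inj_on (\<sigma> g x) (pverts B)"
    proof (rule inj_onI)
      fix b c assume bc: "b \<in> pverts B" "c \<in> pverts B" "\<sigma> g x b = \<sigma> g x c"
      obtain y z where y: "y \<in> ball x" "b = ?L y" and z: "z \<in> ball x" "c = ?L z"
        using surj bc by meson
      then have "g y = g z"
        using bc(3) local_action_apply[OF x] ball_label_inj[OF gx] iso_in_ball[OF g x] by simp
      then have "y = z"
        using graph_isosD(2)[OF g] in_ball_in_verts[OF x] y z by (auto simp: bij_betw_def dest: inj_onD)
      then show "b = c" using y z by simp
    qed
    show "\<sigma> g x ` pverts B = pverts B"
    proof (intro equalityI subsetI)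
      fix c assume "c \<in> \<sigma> g x ` pverts B"
      then obtain y where "y \<in> ball x" "c = \<sigma> g x (?L y)" using surj by blast
      then show "c \<in> pverts B"
        using local_action_apply[OF x] bij_betw_apply[OF ball_label_bij[OF gx]] iso_in_ball[OF g x]
        by simp
    next
      fix c assume "c \<in> pverts B"
      then obtain z where z: "z \<in> ball (g x)" "c = ?L' z"
        using ball_label_bij[OF gx] by (auto simp: bij_betw_def)
      then obtain y where y: "y \<in> ball x" "z = g y"
        using graph_iso_image_ball[OF tree g x] by blast
      then have "c = \<sigma> g x (?L y)" using local_action_apply[OF x] z by simp
      then show "c \<in> \<sigma> g x ` pverts B" using bij_betw_apply[OF ball_label_bij[OF x] y(1)] by blast
    qed
  qed
  moreover have "(b, c) \<in> parcs B \<longleftrightarrow> (\<sigma> g x b, \<sigma> g x c) \<in> parcs B"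
    if bc: "b \<in> pverts B" "c \<in> pverts B" for b c
  proof -
    obtain y z where y: "y \<in> ball x" "b = ?L y" and z: "z \<in> ball x" "c = ?L z"
      using surj bc by meson
    have "(b, c) \<in> parcs B \<longleftrightarrow> (y, z) \<in> parcs T"
      using ball_label_iso[OF x] y z by (simp add: label_isos_ball_iff)
    also have "\<dots> \<longleftrightarrow> (g y, g z) \<in> parcs T"
      using graph_isosD(4)[OF g] in_ball_in_verts[OF x] y z by blast
    also have "\<dots> \<longleftrightarrow> (?L' (g y), ?L' (g z)) \<in> parcs B"
      using ball_label_iso[OF gx] iso_in_ball[OF g x] y z by (simp add: label_isos_ball_iff)
    finally show ?thesis using local_action_apply[OF x] y z by simp
  qed
  ultimately show ?thesis by (simp add: graph_isos_def local_action_def)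
qed

text \<open>
  Multiplying an element of \<open>H\<close> from both sides by label-preserving elements of \<open>H\<close> changes where it
  acts but not its local action. Hence the local actions occurring at one vertex occur, with
  elements of \<open>H\<close>, at every vertex and with every target. By the cocycle identity this makes \<open>F\<close> a
  group. It also shows that a local action in \<open>F\<close> is enough to find an element of \<open>H\<close> with the same
  values on the ball, because the local action at \<open>x\<close> and the image of \<open>x\<close> determine these values.
\<close>

lemma Pk_closure_eq_universal_group:
  assumes H: "subgroup H (Aut T)"
    and transitive: "\<And>y z. y \<in> pverts T \<Longrightarrow> z \<in> pverts T \<Longrightarrow>
      \<exists>\<gamma>\<in>H. \<gamma> y = z \<and> (\<forall>(u, v)\<in>parcs T. l (\<gamma> u, \<gamma> v) = l (u, v))"
  defines "F \<equiv> {\<sigma> h x |h x. h \<in> H \<and> x \<in> pverts T}"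
  shows "subgroup F (Aut B)" "Pk_closure T k H = universal_group T l k B m F"
proof -
  note iso = subgroup_AutD(1)[OF H] and mult = subgroup_AutD(3)[OF H]
  have moving: "\<exists>\<gamma>\<in>H. \<gamma> y = z \<and> (\<forall>v\<in>ball y. \<Lambda> z (\<gamma> v) = \<Lambda> y v)"
    if "y \<in> pverts T" "z \<in> pverts T" for y z
    using transitive[OF that] local_action_label_preserving[OF iso _ that(1)] by blast
  have transport: "\<exists>h'\<in>H. h' x = z \<and> \<sigma> h' x = \<sigma> h y"
    if h: "h \<in> H" and xyz: "x \<in> pverts T" "y \<in> pverts T" "z \<in> pverts T" for h x y z
  proof -
    have hy: "h y \<in> pverts T" using graph_isosD(3)[OF iso[OF h]] xyz by blast
    obtain \<alpha> where \<alpha>: "\<alpha> \<in> H" "\<alpha> x = y" "\<And>v. v \<in> ball x \<Longrightarrow> \<Lambda> y (\<alpha> v) = \<Lambda> x v"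
      using moving xyz by blast
    obtain \<gamma> where \<gamma>: "\<gamma> \<in> H" "\<gamma> (h y) = z" "\<And>v. v \<in> ball (h y) \<Longrightarrow> \<Lambda> z (\<gamma> v) = \<Lambda> (h y) v"
      using moving[OF hy] xyz by blast
    let ?h = "compose (pverts T) \<gamma> (compose (pverts T) h \<alpha>)"
    have h': "?h v = \<gamma> (h (\<alpha> v))" if "v \<in> pverts T" for v
      using that by (simp add: compose_eq)
    have "\<sigma> ?h x = \<sigma> h y"
    proof (rule local_action_eqI[OF xyz(1)])
      fix v assume v: "v \<in> ball x"
      then have \<alpha>v: "\<alpha> v \<in> ball y" using iso_in_ball[OF iso[OF \<alpha>(1)] xyz(1)] \<alpha>(2) by blast
      have "\<sigma> h y (\<Lambda> x v) = \<Lambda> (h y) (h (\<alpha> v))"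
        using local_action_apply[OF xyz(2) \<alpha>v] \<alpha>(3)[OF v] by simp
      also have "\<dots> = \<Lambda> z (\<gamma> (h (\<alpha> v)))"
        using \<gamma>(3) iso_in_ball[OF iso[OF h] xyz(2) \<alpha>v] by simp
      finally show "\<sigma> h y (\<Lambda> x v) = \<Lambda> (?h x) (?h v)"
        using h' xyz in_ball_in_verts[OF xyz(1) v] \<alpha>(2) \<gamma>(2) by simp
    qed (simp add: local_action_def)
    moreover have "?h \<in> H" "?h x = z" using mult h \<alpha> \<gamma> h' xyz by auto
    ultimately show ?thesis by blast
  qed
  have F_sub: "F \<subseteq> graph_isos B B"
    using local_action_in_Aut iso by (auto simp: F_def)
  have id: "\<sigma> (\<lambda>x\<in>pverts T. x) x = \<one>\<^bsub>Aut B\<^esub>" if x: "x \<in> pverts T" for x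
    unfolding one_Aut
    by (rule local_action_eqI[OF x])
      (use x in_ball_in_verts[OF x] bij_betw_apply[OF ball_label_bij[OF x]] in auto)
  have ne: "pverts T \<noteq> {}"
    using tree by (auto simp: serre_tree_def connected_def strongly_connected_def)
  interpret AutB: group "Aut B" by (rule group_Aut)
  show "subgroup F (Aut B)"
  proof (rule AutB.subgroupI)
    show "F \<subseteq> carrier (Aut B)" using F_sub by (simp add: carrier_Aut)
    show "F \<noteq> {}" using ne subgroup_AutD(2)[OF H] by (auto simp: F_def)
  next
    fix a assume "a \<in> F"
    then obtain h x where a: "a = \<sigma> h x" and h: "h \<in> H" and x: "x \<in> pverts T" by (auto simp: F_def)
    obtain h' where h': "h' \<in> H" "\<forall>y\<in>pverts T. h' (h y) = y"
      using subgroup_AutD(4)[OF H h] by blast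
    have hx: "h x \<in> pverts T" using graph_isosD(3)[OF iso[OF h] x] .
    have "compose (pverts T) h' h = (\<lambda>x\<in>pverts T. x)"
      using h'(2) by (auto simp: compose_def)
    then have "compose (pverts B) (\<sigma> h' (h x)) a = \<one>\<^bsub>Aut B\<^esub>"
      using local_action_compose[OF iso[OF h'(1)] iso[OF h] x] id[OF x] a by simp
    moreover have "\<sigma> h' (h x) \<in> F" "a \<in> F" using h' h hx x a by (auto simp: F_def)
    ultimately show "inv\<^bsub>Aut B\<^esub> a \<in> F"
      using AutB.inv_equality[of "\<sigma> h' (h x)" a] F_sub by (auto simp: carrier_Aut mult_Aut subset_iff)
  next
    fix a c assume ac: "a \<in> F" "c \<in> F"
    obtain h y where c: "c = \<sigma> h y" and h: "h \<in> H" and y: "y \<in> pverts T" using ac(2) by (auto simp: F_def)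
    obtain g x where a: "a = \<sigma> g x" and g: "g \<in> H" and x: "x \<in> pverts T" using ac(1) by (auto simp: F_def)
    have hy: "h y \<in> pverts T" using graph_isosD(3)[OF iso[OF h] y] .
    obtain g' where g': "g' \<in> H" "\<sigma> g' (h y) = a" using transport[OF g hy x x] a by blast
    have "a \<otimes>\<^bsub>Aut B\<^esub> c = \<sigma> (compose (pverts T) g' h) y"
      using local_action_compose[OF iso[OF g'(1)] iso[OF h] y] ac F_sub g'(2) c mult_Aut by (metis subsetD)
    then show "a \<otimes>\<^bsub>Aut B\<^esub> c \<in> F" using mult[OF g'(1) h] y by (auto simp: F_def)
  qed
  show "Pk_closure T k H = universal_group T l k B m F"
  proof (intro equalityI subsetI)
    fix g assume g: "g \<in> Pk_closure T k H"
    have "\<sigma> g x \<in> F" if x: "x \<in> pverts T" for x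
    proof -
      obtain h where "h \<in> H" "restrict g (ball x) = restrict h (ball x)"
        using g x by (auto simp: Pk_closure_def)
      then show ?thesis using local_action_cong[OF x, of g h] x by (auto simp: F_def)
    qed
    then show "g \<in> universal_group T l k B m F"
      using g by (simp add: Pk_closure_def universal_group_def)
  next
    fix g assume g: "g \<in> universal_group T l k B m F"
    then have g_iso: "g \<in> graph_isos T T" by (simp add: universal_group_def carrier_Aut)
    have "\<exists>h\<in>H. restrict g (ball x) = restrict h (ball x)" if x: "x \<in> pverts T" for x
    proof -
      have gx: "g x \<in> pverts T" using graph_isosD(3)[OF g_iso x] .
      obtain h y where h: "h \<in> H" "y \<in> pverts T" "\<sigma> g x = \<sigma> h y"
        using g x by (auto simp: universal_group_def F_def)
      obtain h' where h': "h' \<in> H" "h' x = g x" "\<sigma> h' x = \<sigma> g x"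
        using transport[OF h(1) x h(2) gx] h(3) by auto
      have "g v = h' v" if v: "v \<in> ball x" for v
      proof (rule ball_label_inj[OF gx])
        show "g v \<in> ball (g x)" by (rule iso_in_ball[OF g_iso x v])
        show "h' v \<in> ball (g x)" using iso_in_ball[OF iso[OF h'(1)] x v] h'(2) by simp
        show "\<Lambda> (g x) (g v) = \<Lambda> (g x) (h' v)"
          using local_action_apply[OF x v, of g] local_action_apply[OF x v, of h'] h' by simp
      qed
      then show ?thesis using h'(1) by (intro bexI[of _ h'] restrict_ext) auto
    qed
    then show "g \<in> Pk_closure T k H" using g_iso by (simp add: Pk_closure_def carrier_Aut)
  qed
qed

end

theorem theorem4p31:
  fixes T :: "'v pair_pre_digraph" and \<Omega> :: "'o set" and d k :: nat
    and B :: "'b pair_pre_digraph" and m :: "'b \<times> 'b \<Rightarrow> 'o" and H :: "('v \<Rightarrow> 'v) set"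
  assumes "d \<ge> 3" and "card \<Omega> = d"
    and "regular_tree d T"
    and "k \<ge> 1"
    and "labelled_ball_model T \<Omega> k B m"
    and "subgroup H (Aut T)"
    and "locally_transitive T H"
    and "\<exists>\<tau>\<in>H. involutive_inversion T \<tau>"
  shows "\<exists>l F. labelling T \<Omega> l \<and> subgroup F (Aut B) \<and>
           Pk_closure T k H = universal_group T l k B m F"
proof -
  have tree: "serre_tree T" using assms(3) by (simp add: regular_tree_def)
  obtain \<tau> where \<tau>: "\<tau> \<in> H" "involutive_inversion T \<tau>" using assms(8) by blast
  have "d \<ge> 1" using assms(1) by simp
  then obtain l where l: "labelling T \<Omega> l"
    and transitive: "\<And>y z. y \<in> pverts T \<Longrightarrow> z \<in> pverts T \<Longrightarrow>
      \<exists>\<gamma>\<in>H. \<gamma> y = z \<and> (\<forall>(u, v)\<in>parcs T. l (\<gamma> u, \<gamma> v) = l (u, v))"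
    using vertex_transitive_labelling[OF assms(3) _ assms(2,6,7) \<tau>] by blast
  obtain l\<^sub>0 x\<^sub>0 f where l\<^sub>0: "labelling T \<Omega> l\<^sub>0" and x\<^sub>0: "x\<^sub>0 \<in> pverts T"
    and f: "f \<in> label_isos (ball_graph T x\<^sub>0 k) l\<^sub>0 B m"
    using assms(5) by (auto simp: labelled_ball_model_def)
  have trees: "labelled_tree T \<Omega> l" "labelled_tree T \<Omega> l\<^sub>0"
    using tree l l\<^sub>0 by (simp_all add: labelled_tree_def)
  interpret labelled_tree_with_model T \<Omega> l k B m
  proof (intro labelled_tree_with_model.intro trees labelled_tree_with_model_axioms.intro assms(4))
    fix c
    have "\<not> \<Omega> \<subseteq> {c}" using card_mono[of "{c}" \<Omega>] assms(1,2) by auto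
    then show "\<exists>a\<in>\<Omega>. a \<noteq> c" by blast
  next
    fix x assume x: "x \<in> pverts T"
    obtain g where "g \<in> label_isos (ball_graph T x k) l (ball_graph T x\<^sub>0 k) l\<^sub>0"
      using label_iso_of_balls[OF trees x x\<^sub>0] by blast
    from compose_label_isos[OF this f] show "label_isos (ball_graph T x k) l B m \<noteq> {}"
      by (auto simp: ball_graph_def)
  qed
  show ?thesis using l Pk_closure_eq_universal_group[OF assms(6) transitive] by blast
qed

end
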